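(* Let $\triangle PQR$ be a triangle contained in $D$. If $\delta(P,Q,R)<\Delta'(P,Q)$, then $\frac13<\rho(\psi_{\triangle PQR})<\frac12$. If $\delta(P,Q,R)\ge\Delta'(P,Q)$, then $\rho(\psi_{\triangle PQR})=\frac13$.
   Context: $D$ is the open unit disk in $\mathbb{R}^2$ (Beltrami–Klein model) and $S^1$ its boundary, identified with $\mathbb{R}/\mathbb{Z}$ via $t\mapsto(\cos2\pi t,\sin2\pi t)$; $\pi:\mathbb{R}\to S^1$, $\pi(x)=x-\lfloor x\rfloor$. For $P,Q\in D$ with chord endpoints $v_1,v_2\in S^1$, $d'(P,Q)=\frac12\left|\log\frac{|v_1Q||v_2P|}{|v_1P||v_2Q|}\right|$, $\Delta'(P,Q)=\log\frac{e^{d'(P,Q)}+1}{e^{d'(P,Q)}-1}$, and $\delta(P,Q,R)$ is the minimum of $d'(R,S)$ over points $S\in D$ on the line $PQ$. For a (non-degenerate, closed) triangle $\triangle PQR\subset D$ and $v\in S^1$, there are exactly two chords $vv_1,vv_2$ of $S^1$ whose lines support $\triangle PQR$; with $v_1$ the one reached first moving counterclockwise from $v$, set $\psi_{\triangle PQR}(v):=v_1$ (a homeomorphism of $S^1$). $\overline{\psi_{\triangle PQR}}$ is its lift to $\mathbb{R}$ with $\overline{\psi_{\triangle PQR}}(0)\in(0,1)$, and $\rho(\psi_{\triangle PQR})=\lim_{n\to\infty}\overline{\psi_{\triangle PQR}}^{\,n}(0)/n$ is the rotation number. *)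

theory Defs
  imports "HOL-Analysis.Analysis"
begin

text \<open>The plane R^2 is represented by the type complex (x + i y = (x,y)).\<close>

definition kdisk :: "complex set" where
  "kdisk = ball 0 1"

text \<open>Identification of S^1 with R/Z: t maps to (cos 2 pi t, sin 2 pi t).\<close>
definition circ :: "real \<Rightarrow> complex" where
  "circ t = cis (2 * pi * t)"

definition proj :: "real \<Rightarrow> real" where
  "proj x = x - of_int \<lfloor>x\<rfloor>"

definition on_line :: "complex \<Rightarrow> complex \<Rightarrow> complex \<Rightarrow> bool" where
  "on_line P Q S \<longleftrightarrow> (\<exists>t::real. S = P + of_real t * (Q - P))"

definition chord_ends :: "complex \<Rightarrow> complex \<Rightarrow> complex set" where
  "chord_ends P Q = {v. cmod v = 1 \<and> on_line P Q v}"

definition dprime :: "complex \<Rightarrow> complex \<Rightarrow> real" where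
  "dprime P Q = (if P = Q then 0 else
     (SOME r. \<exists>v1 v2. v1 \<noteq> v2 \<and> chord_ends P Q = {v1, v2} \<and>
        r = \<bar>ln ((dist v1 Q * dist v2 P) / (dist v1 P * dist v2 Q))\<bar> / 2))"

definition Deltaprime :: "complex \<Rightarrow> complex \<Rightarrow> real" where
  "Deltaprime P Q = ln ((exp (dprime P Q) + 1) / (exp (dprime P Q) - 1))"

definition delta :: "complex \<Rightarrow> complex \<Rightarrow> complex \<Rightarrow> real" where
  "delta P Q R = Inf {dprime R S | S. S \<in> kdisk \<and> on_line P Q S}"

definition cross :: "complex \<Rightarrow> complex \<Rightarrow> real" where
  "cross a b = Im (cnj a * b)"

definition supports :: "complex \<Rightarrow> complex \<Rightarrow> complex set \<Rightarrow> bool" where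
  "supports a b T \<longleftrightarrow> a \<noteq> b \<and> (\<exists>x\<in>T. on_line a b x) \<and>
     ((\<forall>x\<in>T. cross (b - a) (x - a) \<ge> 0) \<or> (\<forall>x\<in>T. cross (b - a) (x - a) \<le> 0))"

definition triangle :: "complex \<Rightarrow> complex \<Rightarrow> complex \<Rightarrow> complex set" where
  "triangle P Q R = convex hull {P, Q, R}"

text \<open>psi_T as a self-map of S^1 = R/Z, points represented by reals (value in [0,1)):
  psi_T(v) is the other endpoint v1 of the supporting chord through v reached first
  counterclockwise from v, i.e. with the smallest counterclockwise offset s in (0,1).\<close>
definition psi :: "complex set \<Rightarrow> real \<Rightarrow> real" where
  "psi T x = proj (x + Min {s \<in> {0<..<1}. supports (circ x) (circ (x + s)) T})"

definition psi_lift :: "complex set \<Rightarrow> real \<Rightarrow> real" where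
  "psi_lift T = (THE F. continuous_on UNIV F \<and> (\<forall>x. proj (F x) = psi T (proj x))
                        \<and> 0 < F 0 \<and> F 0 < 1)"

definition rotation_number :: "(real \<Rightarrow> real) \<Rightarrow> real" where
  "rotation_number F = lim (\<lambda>n. (F ^^ n) 0 / real n)"

end

theory Submission
  imports Defs
begin

text \<open>The second end point of the chord from \<open>z \<in> S\<^sup>1\<close> through \<open>V\<close> is the image of \<open>z\<close> under the hyperbolic
  half-turn about \<open>V\<close>, which on the circle is a Moebius involution. Its lift \<open>f\<close> to the line satisfies
  \<open>f (f x) = x + 1\<close>, and the lift of \<open>\<psi>\<close> is the minimum \<open>F\<close> of the three lifts at \<open>P\<close>, \<open>Q\<close>, \<open>R\<close>.

  One has \<open>F (F x) \<le> x + 1\<close> with equality only if \<open>P\<close>, \<open>Q\<close>, \<open>R\<close> lie on one chord, whence \<open>\<rho> < 1/2\<close>. Starting at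
  an end of the line \<open>PQ\<close> one finds \<open>F (F (F u)) > u + 1\<close>, whence \<open>\<rho> \<ge> 1/3\<close>, with equality iff
  \<open>F (F (F x)) = x + 1\<close> for some \<open>x\<close>. Such an \<open>x\<close> is a fixed point of the product of the three half-turns
  in some order, and it exists iff that product is not elliptic. By its trace this means
  \<open>K\<^sup>2 \<ge> (1 - |P|\<^sup>2) (1 - |Q|\<^sup>2) (1 - |R|\<^sup>2)\<close>, where \<open>K\<close> is the determinant of \<open>(1, P), (1, Q), (1, R)\<close>. Since
  \<open>sinh \<Delta>' = 1 / sinh d'\<close> and \<open>sinh\<^sup>2 \<delta> sinh\<^sup>2 d'\<close> is the quotient of the two sides, it is equivalent to \<open>\<delta> \<ge> \<Delta>'\<close>.\<close>

section \<open>Rotation numbers\<close>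

definition degree_one_lift :: "(real \<Rightarrow> real) \<Rightarrow> bool" where
  "degree_one_lift F \<longleftrightarrow> mono F \<and> (\<forall>x. F (x + 1) = F x + 1)"

lemma degree_one_lift_add_nat:
  assumes "degree_one_lift F" shows "F (x + real n) = F x + real n"
proof (induction n)
  case (Suc n)
  have "F (x + real (Suc n)) = F ((x + real n) + 1)" by (simp add: algebra_simps)
  also have "\<dots> = F x + real (Suc n)" using assms Suc by (simp add: degree_one_lift_def)
  finally show ?case .
qed simp

lemma degree_one_lift_add_int:
  assumes "degree_one_lift F" shows "F (x + of_int k) = F x + of_int k"
proof (cases "k \<ge> 0")
  case True
  then show ?thesis using degree_one_lift_add_nat[OF assms, of x "nat k"] by simp
next
  case False
  then have "F ((x + of_int k) + real (nat (- k))) = F (x + of_int k) + real (nat (- k))"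
    by (intro degree_one_lift_add_nat assms)
  then show ?thesis using False by simp
qed

lemma degree_one_lift_funpow:
  assumes "degree_one_lift F" shows "degree_one_lift (F ^^ n)"
proof -
  have "(F ^^ n) (x + 1) = (F ^^ n) x + 1" for x
    by (induction n) (use assms in \<open>auto simp: degree_one_lift_def\<close>)
  moreover have "mono (F ^^ n)"
    using assms by (auto simp: degree_one_lift_def intro: mono_pow)
  ultimately show ?thesis by (simp add: degree_one_lift_def)
qed

text \<open>Both \<open>x\<close> and \<open>F x - F 0\<close> lie in the unit interval that starts
  at the integer part of \<open>x\<close>, the latter by monotonicity and the values of
  \<open>F\<close> at integers.\<close>

lemma degree_one_lift_displacement:
  assumes "degree_one_lift F" shows "\<bar>F x - x - F 0\<bar> \<le> 1"
proof -
  have mono: "mono F" using assms by (simp add: degree_one_lift_def)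
  have "F (of_int \<lfloor>x\<rfloor>) = F 0 + of_int \<lfloor>x\<rfloor>" "F (of_int (\<lfloor>x\<rfloor> + 1)) = F 0 + of_int (\<lfloor>x\<rfloor> + 1)"
    using degree_one_lift_add_int[OF assms, of 0] by (metis add_0)+
  moreover have "F (of_int \<lfloor>x\<rfloor>) \<le> F x" "F x \<le> F (of_int (\<lfloor>x\<rfloor> + 1))"
    by (intro monoD[OF mono]; linarith)+
  moreover have "of_int \<lfloor>x\<rfloor> \<le> x" "x < of_int \<lfloor>x\<rfloor> + 1" by linarith+
  ultimately show ?thesis unfolding abs_le_iff of_int_add of_int_1 by linarith
qed

text \<open>The steps telescope. The bound is assumed along a single orbit only, so that it may come
  either from a uniform estimate or from one point.\<close>

lemma funpow_mult_displacement_ge: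
  fixes F :: "real \<Rightarrow> real"
  assumes "\<And>n. (F ^^ q) ((F ^^ (q * n)) x) \<ge> (F ^^ (q * n)) x + c"
  shows "(F ^^ (q * n)) x \<ge> x + real n * c"
proof (induction n)
  case (Suc n)
  have "(F ^^ (q * Suc n)) x = (F ^^ q) ((F ^^ (q * n)) x)"
    by (simp add: funpow_add)
  then show ?case using assms[of n] Suc by (simp add: algebra_simps)
qed simp

lemma funpow_mult_displacement_le:
  fixes F :: "real \<Rightarrow> real"
  assumes "\<And>n. (F ^^ q) ((F ^^ (q * n)) x) \<le> (F ^^ (q * n)) x + c"
  shows "(F ^^ (q * n)) x \<le> x + real n * c"
proof (induction n)
  case (Suc n)
  have "(F ^^ (q * Suc n)) x = (F ^^ q) ((F ^^ (q * n)) x)"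
    by (simp add: funpow_add)
  then show ?case using assms[of n] Suc by (simp add: algebra_simps)
qed simp

text \<open>\<open>(F ^^ (m * n)) 0\<close> is a sum of \<open>n\<close> displacements of
  \<open>F ^^ m\<close>, each within 1 of \<open>(F ^^ m) 0\<close>.\<close>

lemma rotation_number_quotient_dist:
  assumes "degree_one_lift F" "m > 0" "n > 0"
  shows "\<bar>(F ^^ (m * n)) 0 / real (m * n) - (F ^^ m) 0 / real m\<bar> \<le> 1 / real m"
proof -
  let ?a = "(F ^^ m) 0"
  have d: "\<bar>(F ^^ m) y - y - ?a\<bar> \<le> 1" for y
    using degree_one_lift_displacement[OF degree_one_lift_funpow[OF assms(1)]] .
  have "(F ^^ (m * n)) 0 \<ge> 0 + real n * (?a - 1)"
    by (rule funpow_mult_displacement_ge) (use d in \<open>smt (verit)\<close>)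
  moreover have "(F ^^ (m * n)) 0 \<le> 0 + real n * (?a + 1)"
    by (rule funpow_mult_displacement_le) (use d in \<open>smt (verit)\<close>)
  ultimately have "\<bar>(F ^^ (m * n)) 0 - real n * ?a\<bar> \<le> real n"
    by (simp add: algebra_simps abs_le_iff)
  moreover have "(F ^^ (m * n)) 0 / real (m * n) - ?a / real m
      = ((F ^^ (m * n)) 0 - real n * ?a) / real (m * n)"
    using assms by (simp add: field_simps)
  ultimately have "\<bar>(F ^^ (m * n)) 0 / real (m * n) - ?a / real m\<bar> \<le> real n / real (m * n)"
    using divide_right_mono[of _ "real n" "real (m * n)"] by (simp only: abs_divide abs_of_nat of_nat_0_le_iff)
  then show ?thesis using assms by simp
qed

text \<open>The quotients at \<open>m\<close> and at \<open>n\<close> are both close to the one at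
  \<open>m * n\<close>, so the sequence is Cauchy and \<open>lim\<close> denotes a genuine
  limit.\<close>

lemma rotation_number_LIMSEQ:
  assumes "degree_one_lift F"
  shows "(\<lambda>n. (F ^^ n) 0 / real n) \<longlonglongrightarrow> rotation_number F"
proof -
  let ?s = "\<lambda>n. (F ^^ n) 0 / real n"
  have near: "\<bar>?s m - ?s n\<bar> \<le> 1 / real m + 1 / real n" if "m > 0" "n > 0" for m n
    using rotation_number_quotient_dist[OF assms that]
      rotation_number_quotient_dist[OF assms that(2,1)]
    by (simp add: mult.commute abs_le_iff)
  have "Cauchy ?s"
  proof (rule metric_CauchyI)
    fix e :: real assume "e > 0"
    then obtain N where N: "N > 0" "1 / real N < e / 2"
      by (metis half_gt_zero_iff inverse_eq_divide ex_inverse_of_nat_less)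
    have "dist (?s m) (?s n) < e" if "m \<ge> N" "n \<ge> N" for m n
    proof -
      have "1 / real m \<le> 1 / real N" "1 / real n \<le> 1 / real N"
        using that N by (auto simp: frac_le)
      then show ?thesis using near[of m n] that N by (simp add: dist_real_def)
    qed
    then show "\<exists>M. \<forall>m\<ge>M. \<forall>n\<ge>M. dist (?s m) (?s n) < e" by blast
  qed
  then show ?thesis
    unfolding rotation_number_def using Cauchy_convergent convergent_LIMSEQ_iff by blast
qed

text \<open>Passing from base point 0 to \<open>x\<close> changes the displacement of an iterate by
  at most 1, which disappears after division.\<close>

lemma rotation_number_subseq:
  assumes "degree_one_lift F" "q > 0"
  shows "(\<lambda>n. ((F ^^ (q * n)) x - x) / (real q * real n)) \<longlonglongrightarrow> rotation_number F"
proof -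
  have "strict_mono (\<lambda>n. q * n)" using assms(2) by (simp add: strict_mono_def)
  from LIMSEQ_subseq_LIMSEQ[OF rotation_number_LIMSEQ[OF assms(1)] this]
  have 1: "(\<lambda>n. (F ^^ (q * n)) 0 / (real q * real n)) \<longlonglongrightarrow> rotation_number F"
    by (simp add: o_def)
  have 2: "(\<lambda>n. ((F ^^ (q * n)) x - x - (F ^^ (q * n)) 0) / (real q * real n)) \<longlonglongrightarrow> 0"
  proof (rule Lim_null_comparison)
    show "\<forall>\<^sub>F n in sequentially. norm (((F ^^ (q * n)) x - x - (F ^^ (q * n)) 0) / (real q * real n))
        \<le> inverse (real q) * inverse (real n)"
    proof (rule always_eventually, rule allI)
      fix n
      have "\<bar>(F ^^ (q * n)) x - x - (F ^^ (q * n)) 0\<bar> \<le> 1"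
        by (intro degree_one_lift_displacement degree_one_lift_funpow assms)
      then have "\<bar>(F ^^ (q * n)) x - x - (F ^^ (q * n)) 0\<bar> / (real q * real n) \<le> 1 / (real q * real n)"
        by (intro divide_right_mono) auto
      then show "norm (((F ^^ (q * n)) x - x - (F ^^ (q * n)) 0) / (real q * real n))
        \<le> inverse (real q) * inverse (real n)"
        by (simp add: abs_mult field_simps)
    qed
    show "(\<lambda>n. inverse (real q) * inverse (real n)) \<longlonglongrightarrow> 0"
      by (intro tendsto_mult_right_zero lim_inverse_n)
  qed
  have "(\<lambda>n. (F ^^ (q * n)) 0 / (real q * real n)
      + ((F ^^ (q * n)) x - x - (F ^^ (q * n)) 0) / (real q * real n)) \<longlonglongrightarrow> rotation_number F + 0"
    by (rule tendsto_add[OF 1 2])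
  then show ?thesis by (simp add: add_divide_distrib[symmetric])
qed

section \<open>Bounds for the rotation number from displacements\<close>

lemma rotation_number_ge:
  assumes "degree_one_lift F" "q > 0"
    and "\<And>n. (F ^^ q) ((F ^^ (q * n)) x) \<ge> (F ^^ (q * n)) x + c"
  shows "rotation_number F \<ge> c / real q"
proof (rule LIMSEQ_le_const[OF rotation_number_subseq[OF assms(1,2)]])
  show "\<exists>N. \<forall>n\<ge>N. c / real q \<le> ((F ^^ (q * n)) x - x) / (real q * real n)"
  proof (intro exI[of _ 1] allI impI)
    fix n :: nat assume "n \<ge> 1"
    then show "c / real q \<le> ((F ^^ (q * n)) x - x) / (real q * real n)"
    proof -
      have "(real n * c) / (real q * real n) \<le> ((F ^^ (q * n)) x - x) / (real q * real n)"
        using funpow_mult_displacement_ge[where F = F and q = q and x = x and c = c, OF assms(3), of n]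
        by (intro divide_right_mono) auto
      then show ?thesis using \<open>n \<ge> 1\<close> by simp
    qed
  qed
qed

lemma rotation_number_le:
  assumes "degree_one_lift F" "q > 0"
    and "\<And>n. (F ^^ q) ((F ^^ (q * n)) x) \<le> (F ^^ (q * n)) x + c"
  shows "rotation_number F \<le> c / real q"
proof (rule LIMSEQ_le_const2[OF rotation_number_subseq[OF assms(1,2)]])
  show "\<exists>N. \<forall>n\<ge>N. ((F ^^ (q * n)) x - x) / (real q * real n) \<le> c / real q"
  proof (intro exI[of _ 1] allI impI)
    fix n :: nat assume "n \<ge> 1"
    then show "((F ^^ (q * n)) x - x) / (real q * real n) \<le> c / real q"
    proof -
      have "((F ^^ (q * n)) x - x) / (real q * real n) \<le> (real n * c) / (real q * real n)"
        using funpow_mult_displacement_le[where F = F and q = q and x = x and c = c, OF assms(3), of n]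
        by (intro divide_right_mono) auto
      then show ?thesis using \<open>n \<ge> 1\<close> by simp
    qed
  qed
qed

text \<open>One point suffices: \<open>F ^^ (q * n)\<close> is monotone and commutes with
  \<open>F ^^ q\<close> and with the unit translation, so it carries the inequality at
  \<open>x\<close> along the orbit.\<close>

lemma rotation_number_ge_at:
  assumes F: "degree_one_lift F" and "q > 0" and x: "(F ^^ q) x \<ge> x + 1"
  shows "rotation_number F \<ge> 1 / real q"
proof (rule rotation_number_ge[OF assms(1,2)])
  fix n
  have L: "degree_one_lift (F ^^ (q * n))" by (rule degree_one_lift_funpow[OF F])
  have "(F ^^ (q * n)) x + 1 = (F ^^ (q * n)) (x + 1)" using L by (simp add: degree_one_lift_def)
  also have "\<dots> \<le> (F ^^ (q * n)) ((F ^^ q) x)" using L x unfolding degree_one_lift_def by (blast dest: monoD)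
  also have "\<dots> = (F ^^ q) ((F ^^ (q * n)) x)"
    by (metis add.commute comp_apply funpow_add)
  finally show "(F ^^ q) ((F ^^ (q * n)) x) \<ge> (F ^^ (q * n)) x + 1" .
qed

lemma rotation_number_le_at:
  assumes F: "degree_one_lift F" and "q > 0" and x: "(F ^^ q) x \<le> x + 1"
  shows "rotation_number F \<le> 1 / real q"
proof (rule rotation_number_le[OF assms(1,2)])
  fix n
  have L: "degree_one_lift (F ^^ (q * n))" by (rule degree_one_lift_funpow[OF F])
  have "(F ^^ q) ((F ^^ (q * n)) x) = (F ^^ (q * n)) ((F ^^ q) x)"
    by (metis add.commute comp_apply funpow_add)
  also have "\<dots> \<le> (F ^^ (q * n)) (x + 1)" using L x unfolding degree_one_lift_def by (blast dest: monoD)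
  also have "\<dots> = (F ^^ (q * n)) x + 1" using L by (simp add: degree_one_lift_def)
  finally show "(F ^^ q) ((F ^^ (q * n)) x) \<le> (F ^^ (q * n)) x + 1" .
qed

section \<open>Strict bounds by compactness of a period\<close>

lemma periodic_continuous_attains_inf:
  fixes g :: "real \<Rightarrow> real"
  assumes "continuous_on UNIV g" "\<And>x. g (x + 1) = g x"
  obtains y where "\<And>x. g y \<le> g x"
proof -
  have "continuous_on {0..1} g" using assms(1) continuous_on_subset by blast
  then obtain y where y: "y \<in> {0..1}" "\<forall>x\<in>{0..1}. g y \<le> g x"
    using continuous_attains_inf[of "{0..1::real}" g] by auto
  have nat: "g (x + real n) = g x" for x n
  proof (induction n)
    case (Suc n)
    then show ?case using assms(2)[of "x + real n"] by (simp add: algebra_simps)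
  qed simp
  have int: "g (x + of_int k) = g x" for x k
    using nat[of x "nat k"] nat[of "x + of_int k" "nat (- k)"] by (cases "k \<ge> 0") auto
  have "g y \<le> g x" for x
  proof -
    have "x + of_int (- \<lfloor>x\<rfloor>) \<in> {0..1}" by simp linarith
    then have "g y \<le> g (x + of_int (- \<lfloor>x\<rfloor>))" using y by blast
    then show ?thesis unfolding int .
  qed
  then show ?thesis using that by blast
qed

text \<open>The displacement of \<open>F ^^ q\<close> is continuous and periodic, so it attains its
  minimum. This minimum exceeds 1, and the margin survives the limit.\<close>

lemma rotation_number_greater:
  assumes F: "degree_one_lift F" and cont: "continuous_on UNIV (F ^^ q)" and "q > 0"
    and gt: "\<And>x. (F ^^ q) x > x + 1"
  shows "rotation_number F > 1 / real q"
proof -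
  have "continuous_on UNIV (\<lambda>x. (F ^^ q) x - x)"
    by (intro continuous_intros cont)
  moreover have "(F ^^ q) (x + 1) - (x + 1) = (F ^^ q) x - x" for x
    using degree_one_lift_funpow[OF F, of q] by (simp add: degree_one_lift_def)
  ultimately obtain y where y: "\<And>x. (F ^^ q) y - y \<le> (F ^^ q) x - x"
    by (rule periodic_continuous_attains_inf[where g = "\<lambda>x. (F ^^ q) x - x"]) auto
  have "1 / real q < ((F ^^ q) y - y) / real q"
    using gt[of y] \<open>q > 0\<close> by (simp add: divide_strict_right_mono)
  also have "\<dots> \<le> rotation_number F"
    by (rule rotation_number_ge[OF F \<open>q > 0\<close>, where x = 0]) (use y in \<open>smt (verit)\<close>)
  finally show ?thesis .
qed

lemma rotation_number_less:
  assumes F: "degree_one_lift F" and cont: "continuous_on UNIV (F ^^ q)" and "q > 0"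
    and lt: "\<And>x. (F ^^ q) x < x + 1"
  shows "rotation_number F < 1 / real q"
proof -
  have "continuous_on UNIV (\<lambda>x. x - (F ^^ q) x)"
    by (intro continuous_intros cont)
  moreover have "(x + 1) - (F ^^ q) (x + 1) = x - (F ^^ q) x" for x
    using degree_one_lift_funpow[OF F, of q] by (simp add: degree_one_lift_def)
  ultimately obtain y where y: "\<And>x. y - (F ^^ q) y \<le> x - (F ^^ q) x"
    by (rule periodic_continuous_attains_inf[where g = "\<lambda>x. x - (F ^^ q) x"]) auto
  have "rotation_number F \<le> ((F ^^ q) y - y) / real q"
    by (rule rotation_number_le[OF F \<open>q > 0\<close>, where x = 0]) (use y in \<open>smt (verit)\<close>)
  also have "\<dots> < 1 / real q"
    using lt[of y] \<open>q > 0\<close> by (simp add: divide_strict_right_mono)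
  finally show ?thesis .
qed

section \<open>The minimum of three lifted half-turns\<close>

text \<open>The lift, with displacements between 0 and 1, of a circle involution without fixed
  points.\<close>

definition half_turn_lift :: "(real \<Rightarrow> real) \<Rightarrow> bool" where
  "half_turn_lift f \<longleftrightarrow> continuous_on UNIV f \<and> (\<forall>x. x < f x) \<and> (\<forall>x. f (f x) = x + 1)"

text \<open>For monotonicity: \<open>f\<close> is injective because \<open>f (f x)\<close>
  determines \<open>x\<close>, a continuous injection of the line is strictly monotone, and
  commuting with the unit translation excludes a decreasing one.\<close>

lemma half_turn_lift_props:
  assumes "half_turn_lift f"
  shows "continuous_on UNIV f" "x < f x" "f (f x) = x + 1" "f x < x + 1" "f (x + 1) = f x + 1"
    "strict_mono f"
proof -
  show c: "continuous_on UNIV f" and gt: "x < f x" and ff: "f (f x) = x + 1" for x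
    using assms by (auto simp: half_turn_lift_def)
  show "f x < x + 1" using gt[of "f x"] ff[of x] by simp
  show p: "f (x + 1) = f x + 1" for x using ff[of x] ff[of "f x"] by simp
  have "inj f" by (rule injI) (metis ff add_right_cancel)
  then have "strict_mono_on UNIV f \<or> strict_antimono_on UNIV f"
    using injective_eq_monotone_map[of UNIV f] c is_interval_univ by blast
  moreover have "\<not> strict_antimono_on UNIV f"
  proof
    assume "strict_antimono_on UNIV f"
    then have "f 1 < f 0" by (simp add: monotone_on_def)
    then show False using p[of 0] by simp
  qed
  ultimately show "strict_mono f" by auto
qed

lemma half_turn_lift_less_iff: "half_turn_lift f \<Longrightarrow> f x < f y \<longleftrightarrow> x < y"
  using half_turn_lift_props(6) strict_mono_less by blast

text \<open>If \<open>f < g\<close> everywhere, then \<open>f (f 0) < g (f 0) < g (g 0)\<close>,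
  although both ends equal 1. So neither lift dominates and the intermediate value theorem applies.
  Geometrically \<open>u\<close> is an end of the chord through two vertices.\<close>

lemma half_turn_lifts_meet:
  assumes f: "half_turn_lift f" and g: "half_turn_lift g"
  obtains u where "f u = g u"
proof -
  have 1: "\<exists>x. f x \<ge> g x" if f: "half_turn_lift f" and g: "half_turn_lift g" for f g
  proof (rule ccontr)
    assume "\<not> ?thesis"
    then have lt: "f x < g x" for x by (simp add: not_le)
    have "f (f 0) < g (f 0)" by (rule lt)
    also have "\<dots> < g (g 0)" using lt half_turn_lift_less_iff[OF g] by simp
    finally show False using half_turn_lift_props(3)[OF f] half_turn_lift_props(3)[OF g] by simp
  qed
  obtain x y where x: "f x - g x \<ge> 0" and y: "f y - g y \<le> 0"
    using 1[OF f g] 1[OF g f] by auto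
  have c: "continuous_on A (\<lambda>x. f x - g x)" for A
    using half_turn_lift_props(1)[OF f] half_turn_lift_props(1)[OF g]
    by (intro continuous_intros) (auto intro: continuous_on_subset)
  have "connected ((\<lambda>x. f x - g x) ` UNIV)"
    by (intro connected_continuous_image c connected_UNIV)
  then have "0 \<in> range (\<lambda>x. f x - g x)"
    using x y by (meson connectedD_interval rangeI)
  then show ?thesis using that by auto
qed

text \<open>Since each factor moves points by less than 1, \<open>k\<close> is 1 or 2. Up to
  translation by 3, the reversed product is the inverse of the given one, so a displacement of 2 for
  one order is a displacement of 1 for the other.\<close>

lemma half_turn_lift_triple:
  assumes f: "half_turn_lift f" and g: "half_turn_lift g" and h: "half_turn_lift h"
    and k: "h (g (f x)) = x + of_int k"
  shows "h (g (f x)) = x + 1 \<or> f (g (h x)) = x + 1"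
proof -
  note pf = half_turn_lift_props[OF f] and pg = half_turn_lift_props[OF g]
    and ph = half_turn_lift_props[OF h]
  have "x < h (g (f x))" "h (g (f x)) < x + 3"
    using pf(2)[of x] pg(2)[of "f x"] ph(2)[of "g (f x)"]
      pf(4)[of x] pg(4)[of "f x"] ph(4)[of "g (f x)"] by linarith+
  then have "k = 1 \<or> k = 2" using k by linarith
  then show ?thesis
  proof
    assume "k = 2"
    then have "h (g (f x)) = (x + 1) + 1" using k by simp
    moreover have "f (g (h (h (g (f x))))) = x + 1 + 1 + 1"
      by (simp only: pf(3,5) pg(3,5) ph(3,5))
    moreover have "f (g (h (x + 1 + 1))) = f (g (h x)) + 1 + 1"
      by (simp only: pf(5) pg(5) ph(5))
    ultimately have "f (g (h x)) = x + 1" by simp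
    then show ?thesis ..
  qed (use k in simp)
qed

text \<open>\<open>no_common\<close> is non-collinearity seen from the circle: no chord passes
  through all three points.\<close>

locale three_half_turns =
  fixes f g h :: "real \<Rightarrow> real"
  assumes f: "half_turn_lift f" and g: "half_turn_lift g" and h: "half_turn_lift h"
    and no_common: "\<not> (f x = g x \<and> g x = h x)"
begin

definition F :: "real \<Rightarrow> real" where "F x = min (f x) (min (g x) (h x))"

lemma F_cases: obtains k where "k \<in> {f, g, h}" "F x = k x"
  unfolding F_def min_def by (metis insertCI)

lemma F_le: "k \<in> {f, g, h} \<Longrightarrow> F x \<le> k x"
  by (auto simp: F_def)

lemma half: "k \<in> {f, g, h} \<Longrightarrow> half_turn_lift k"
  using f g h by auto

lemma F_less: "x < F x" "F x < x + 1"
  using half_turn_lift_props(2,4)[OF f, of x] half_turn_lift_props(2,4)[OF g, of x]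
    half_turn_lift_props(2,4)[OF h, of x]
  by (auto simp: F_def)

lemma continuous_F: "continuous_on A F"
proof -
  have "continuous_on UNIV F"
    unfolding F_def using half_turn_lift_props(1)[OF f] half_turn_lift_props(1)[OF g]
      half_turn_lift_props(1)[OF h] by (intro continuous_intros)
  then show ?thesis by (rule continuous_on_subset) simp
qed

lemma F_strict_mono: "x < y \<Longrightarrow> F x < F y"
  using half_turn_lift_less_iff[OF f, of x y] half_turn_lift_less_iff[OF g, of x y]
    half_turn_lift_less_iff[OF h, of x y] by (auto simp: F_def)

lemma degree_one_F: "degree_one_lift F"
proof -
  have "mono F" using F_strict_mono by (intro monoI) (metis le_less)
  moreover have "F (x + 1) = F x + 1" for x
    using half_turn_lift_props(5)[OF f, of x] half_turn_lift_props(5)[OF g, of x]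
      half_turn_lift_props(5)[OF h, of x] by (simp add: F_def min_def)
  ultimately show ?thesis by (simp add: degree_one_lift_def)
qed

lemma continuous_F_funpow: "continuous_on UNIV (F ^^ n)"
proof (induction n)
  case (Suc n)
  then show ?case using continuous_on_compose[OF Suc continuous_F] by (simp add: o_def)
qed (simp add: id_def)

text \<open>If \<open>k\<close> attains the minimum at \<open>x\<close>, then
  \<open>F (F x) \<le> k (k x) = x + 1\<close>. In the case of equality every \<open>j\<close>
  satisfies \<open>j (F x) \<ge> x + 1\<close>; applying \<open>j\<close> once more gives
  \<open>j x \<le> F x\<close>, so all three lifts agree at \<open>x\<close>.\<close>

lemma F_F_less: "F (F x) < x + 1"
proof -
  obtain k where k: "k \<in> {f, g, h}" "F x = k x" by (rule F_cases)
  have le: "F (F x) \<le> x + 1"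
    using F_le[OF k(1), of "F x"] k half_turn_lift_props(3)[OF half[OF k(1)], of x] by simp
  have "F (F x) \<noteq> x + 1"
  proof
    assume eq: "F (F x) = x + 1"
    have "j x = F x" if j: "j \<in> {f, g, h}" for j
    proof -
      note pj = half_turn_lift_props[OF half[OF j]]
      have "x + 1 \<le> j (F x)" using F_le[OF j, of "F x"] eq by simp
      then have "j (x + 1) \<le> j (j (F x))"
        using half_turn_lift_less_iff[OF half[OF j]] not_less by blast
      then have "j x \<le> F x" using pj(3,5) by simp
      then show ?thesis using F_le[OF j, of x] by simp
    qed
    then show False using no_common[of x] by (metis insertCI)
  qed
  then show ?thesis using le by simp
qed

lemma rotation_number_F_less: "rotation_number F < 1 / 2"
  using rotation_number_less[OF degree_one_F continuous_F_funpow, of 2] F_F_less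
  by (simp add: numeral_2_eq_2)

text \<open>Let \<open>u\<close> and \<open>b\<close> be the ends of the chord of \<open>f\<close>
  and \<open>g\<close>. At \<open>b\<close> these two return to \<open>u + 1\<close>, so
  \<open>h\<close> is smaller there and leads to some \<open>c\<close> with
  \<open>b < c < u + 1\<close>. From \<open>c\<close>, all three lifts pass
  \<open>u + 1\<close>.\<close>

lemma F3_greater_aux:
  assumes eq: "f u = g u" and gt: "f u < h u"
  shows "F (F (F u)) > u + 1"
proof -
  note pf = half_turn_lift_props[OF f] and pg = half_turn_lift_props[OF g]
    and ph = half_turn_lift_props[OF h]
  define b where "b = f u"
  have Fu: "F u = b" using eq gt by (simp add: F_def b_def)
  have fb: "f b = u + 1" "g b = u + 1" using pf(3)[of u] pg(3)[of u] eq by (simp_all add: b_def)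
  define c where "c = h b"
  have "c < h (h u)" using gt half_turn_lift_less_iff[OF h] by (simp add: c_def b_def)
  then have cu: "c < u + 1" using ph(3) by simp
  have Fb: "F b = c" using fb cu by (simp add: F_def c_def)
  have bc: "b < c" using ph(2) by (simp add: c_def)
  have "f c > u + 1" "g c > u + 1"
    using half_turn_lift_less_iff[OF f] half_turn_lift_less_iff[OF g] bc fb by metis+
  moreover have "h c = b + 1" "u < b" using ph(3) pf(2) by (simp_all add: c_def b_def)
  ultimately have "F c > u + 1" by (simp add: F_def)
  then show ?thesis using Fu Fb by simp
qed

text \<open>The common value of \<open>f\<close> and \<open>g\<close> corresponds to a side of the triangle; one of the two
  orientations of its chord has the triangle on its left.\<close>
lemma F3_greater: obtains u where "F (F (F u)) > u + 1"
proof -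
  obtain u where u: "f u = g u" using half_turn_lifts_meet[OF f g] .
  show ?thesis
  proof (cases "f u < h u")
    case True
    then show ?thesis using F3_greater_aux[OF u] that by blast
  next
    case False
    then have lt: "h u < f u" using no_common[of u] u by auto
    note pf = half_turn_lift_props[OF f] and pg = half_turn_lift_props[OF g]
      and ph = half_turn_lift_props[OF h]
    have "f (f u) = g (f u)" using pf(3)[of u] pg(3)[of u] u by simp
    moreover have "h (f u) > h (h u)" using lt half_turn_lift_less_iff[OF h] by simp
    then have "f (f u) < h (f u)" using pf(3) ph(3) by simp
    ultimately show ?thesis using F3_greater_aux that by blast
  qed
qed

lemma rotation_number_F_ge: "rotation_number F \<ge> 1 / 3"
proof -
  obtain u where "F (F (F u)) > u + 1" by (rule F3_greater)
  then show ?thesis using rotation_number_ge_at[OF degree_one_F, of 3 u]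
    by (simp add: numeral_3_eq_3)
qed

text \<open>Monotonicity of \<open>F\<close> lets each factor of the product be replaced by the
  smaller \<open>F\<close>, which gives the upper bound at \<open>x\<close>.\<close>

lemma rotation_number_F_eq:
  assumes "k \<in> {f, g, h}" "l \<in> {f, g, h}" "m \<in> {f, g, h}" "m (l (k x)) = x + 1"
  shows "rotation_number F = 1 / 3"
proof -
  have "F (F (F x)) \<le> F (F (k x))"
    using degree_one_F F_le[OF assms(1)] by (simp add: degree_one_lift_def monoD)
  also have "\<dots> \<le> F (l (k x))"
    using degree_one_F F_le[OF assms(2)] by (simp add: degree_one_lift_def monoD)
  also have "\<dots> \<le> m (l (k x))" by (rule F_le[OF assms(3)])
  finally have "(F ^^ 3) x \<le> x + 1" using assms(4) by (simp add: numeral_3_eq_3)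
  from rotation_number_le_at[OF degree_one_F _ this] rotation_number_F_ge
  show ?thesis by simp
qed

text \<open>If \<open>F (F (F x)) = x + 1\<close>, the three lifts that realize the minimum along
  the orbit are pairwise distinct, which the hypotheses exclude. Hence the continuous function
  \<open>F (F (F x)) - x - 1\<close> has no zero, and it is positive somewhere.\<close>

lemma rotation_number_F_greater:
  assumes hgf: "\<And>x. h (g (f x)) \<noteq> x + 1" and fgh: "\<And>x. f (g (h x)) \<noteq> x + 1"
  shows "rotation_number F > 1 / 3"
proof -
  have ne: "F (F (F x)) \<noteq> x + 1" for x
  proof
    assume eq: "F (F (F x)) = x + 1"
    obtain k where k: "k \<in> {f, g, h}" "F x = k x" by (rule F_cases)
    obtain l where l: "l \<in> {f, g, h}" "F (F x) = l (F x)" by (rule F_cases)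
    obtain m where m: "m \<in> {f, g, h}" "F (F (F x)) = m (F (F x))" by (rule F_cases)
    have "k \<noteq> l" using F_F_less[of x] k l half_turn_lift_props(3)[OF half[OF k(1)], of x] by auto
    moreover have "l \<noteq> m"
      using F_F_less[of "F x"] l m half_turn_lift_props(3)[OF half[OF l(1)], of "F x"] by auto
    moreover have "k \<noteq> m"
    proof
      assume "k = m"
      then have "k (k (F (F x))) = k (x + 1)" using m eq by simp
      then have "F (F x) = F x" using k half_turn_lift_props(3,5)[OF half[OF k(1)]] by simp
      then show False using F_less(1)[of "F x"] by simp
    qed
    ultimately consider "k = f" "l = g" "m = h" | "k = g" "l = h" "m = f" | "k = h" "l = f" "m = g"
      | "k = h" "l = g" "m = f" | "k = g" "l = f" "m = h" | "k = f" "l = h" "m = g"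
      using k(1) l(1) m(1) by auto
    \<comment> \<open>Starting from the next points of the orbit permutes the factors cyclically, so
      the six orders reduce to the two in the hypotheses.\<close>
    moreover have e1: "m (l (k x)) = x + 1" using k l m eq by simp
    moreover have e2: "k (m (l (k x))) = k x + 1"
      using e1 half_turn_lift_props(5)[OF half[OF k(1)]] by simp
    moreover have "l (k (m (l (k x)))) = l (k x) + 1"
      using e2 half_turn_lift_props(5)[OF half[OF l(1)]] by simp
    ultimately show False using hgf fgh by cases blast+
  qed
  obtain u where u: "F (F (F u)) > u + 1" by (rule F3_greater)
  have "F (F (F x)) > x + 1" for x
  proof (rule ccontr)
    assume "\<not> ?thesis"
    then have "F (F (F x)) - x - 1 \<le> 0" by simp
    moreover have "F (F (F u)) - u - 1 \<ge> 0" using u by simp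
    moreover have "connected (range (\<lambda>x. F (F (F x)) - x - 1))"
    proof (intro connected_continuous_image connected_UNIV)
      show "continuous_on UNIV (\<lambda>x. F (F (F x)) - x - 1)"
        using continuous_F_funpow[of 3] by (intro continuous_intros) (simp add: numeral_3_eq_3 o_def)
    qed
    ultimately have "0 \<in> range (\<lambda>x. F (F (F x)) - x - 1)"
      by (meson connectedD_interval rangeI)
    then obtain z where "0 = F (F (F z)) - z - 1" by (rule rangeE)
    then have "F (F (F z)) = z + 1" by simp
    then show False using ne by simp
  qed
  then show ?thesis
    using rotation_number_greater[OF degree_one_F continuous_F_funpow, of 3]
    by (simp add: numeral_3_eq_3)
qed

end

section \<open>Supporting chords of a triangle\<close>

lemma norm_circ [simp]: "cmod (circ x) = 1"
  by (simp add: circ_def)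

lemma circ_cnj [simp]: "circ x * cnj (circ x) = 1"
  by (simp add: complex_norm_square[symmetric])

lemma circ_add: "circ (x + y) = circ x * circ y"
  by (simp add: circ_def cis_mult algebra_simps)

lemma circ_eq_iff: "circ x = circ y \<longleftrightarrow> (\<exists>k::int. x = y + of_int k)"
proof -
  have "circ x = circ y \<longleftrightarrow> cis (2 * pi * (x - y)) = 1"
    unfolding circ_def by (simp add: right_diff_distrib cis_divide[symmetric])
  also have "\<dots> \<longleftrightarrow> cos (2 * pi * (x - y)) = 1"
    using cos_one_sin_zero by (auto simp: complex_eq_iff)
  also have "\<dots> \<longleftrightarrow> (\<exists>k::int. 2 * pi * (x - y) = of_int k * 2 * pi)"
    by (rule cos_one_2pi_int)
  also have "\<dots> \<longleftrightarrow> (\<exists>k::int. x = y + of_int k)"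
  proof -
    have "2 * pi * (x - y) = of_int k * 2 * pi \<longleftrightarrow> (2 * pi) * (x - y) = (2 * pi) * of_int k"
      for k :: int by (simp only: mult_ac)
    also have "\<dots> k \<longleftrightarrow> x = y + of_int k" for k by auto
    finally show ?thesis by simp
  qed
  finally show ?thesis .
qed

lemma circ_surj: assumes "cmod z = 1" obtains x where "z = circ x"
proof -
  have "z = cis (Arg z)" using assms cis_Arg[of z] by (simp add: sgn_eq) (metis norm_zero zero_neq_one)
  then have "z = circ (Arg z / (2 * pi))" by (simp add: circ_def)
  then show ?thesis using that by blast
qed

text \<open>For \<open>z\<close> and \<open>w\<close> on the unit circle, the chord
  \<open>z w\<close> contains \<open>V\<close> iff \<open>z + w = V + z * w * cnj V\<close>; this is
  solved for \<open>w\<close>.\<close>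

definition half_turn :: "complex \<Rightarrow> complex \<Rightarrow> complex" where
  "half_turn V z = (V - z) / (1 - cnj V * z)"

text \<open>With \<open>q = 1 - V * cnj z\<close>, the half-turn sends \<open>z\<close> to
  \<open>- z * q / cnj q\<close>. The sign contributes 1/2 and \<open>q / cnj q\<close> contributes
  \<open>Arg q / pi\<close>. As \<open>Re q > 0\<close>, this argument is continuous and lies
  strictly between -1/2 and 1/2.\<close>

definition chord_lift :: "complex \<Rightarrow> real \<Rightarrow> real" where
  "chord_lift V x = x + 1/2 + Arg (1 - V * cnj (circ x)) / pi"

lemma Re_one_minus_pos:
  assumes "cmod V < 1" "cmod z \<le> 1" shows "Re (1 - V * z) > 0"
proof -
  have "Re (V * z) \<le> cmod V * cmod z" by (metis complex_Re_le_cmod norm_mult)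
  also have "\<dots> \<le> cmod V" using assms(2) by (simp add: mult_left_le)
  finally show ?thesis using assms(1) by simp
qed

lemma one_minus_neq_0: "cmod V < 1 \<Longrightarrow> cmod z \<le> 1 \<Longrightarrow> 1 - V * z \<noteq> 0"
  using Re_one_minus_pos[of V z] by (metis less_irrefl zero_complex.simps(1))

lemma chord_lift_bounds:
  assumes "cmod V < 1" shows "x < chord_lift V x" "chord_lift V x < x + 1"
proof -
  have "\<bar>Arg (1 - V * cnj (circ x))\<bar> < pi / 2"
    using Re_one_minus_pos[OF assms, of "cnj (circ x)"] Arg_Re_pos by auto
  then have "\<bar>Arg (1 - V * cnj (circ x)) / pi\<bar> < 1/2" by (simp add: field_simps)
  then show "x < chord_lift V x" "chord_lift V x < x + 1"
    unfolding chord_lift_def by linarith+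
qed

lemma circ_chord_lift:
  assumes "cmod V < 1" shows "circ (chord_lift V x) = half_turn V (circ x)"
proof -
  define q where "q = 1 - V * cnj (circ x)"
  have q: "q \<noteq> 0" using one_minus_neq_0[OF assms] by (simp add: q_def)
  have sq: "sgn q * sgn q = q / cnj q"
  proof -
    have "sgn q * sgn q = q * q / (of_real (cmod q))\<^sup>2"
      by (simp add: sgn_eq power2_eq_square)
    also have "(complex_of_real (cmod q))\<^sup>2 = q * cnj q"
      using complex_norm_square[of q] by simp
    finally show ?thesis using q by simp
  qed
  have "circ (chord_lift V x) = circ x * (circ (1/2) * circ (Arg q / pi))"
    unfolding chord_lift_def q_def[symmetric] circ_add by (simp add: mult.assoc)
  also have "circ (1/2) = -1" by (simp add: circ_def cis_pi)
  also have "circ (Arg q / pi) = cis (Arg q) * cis (Arg q)"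
    by (simp add: circ_def cis_mult mult_2[symmetric])
  also have "\<dots> = q / cnj q" using cis_Arg[OF q] sq by simp
  also have "circ x * (- 1 * (q / cnj q)) = (- circ x * q) / cnj q" by simp
  also have "- circ x * q = V * (circ x * cnj (circ x)) - circ x"
    by (simp add: q_def algebra_simps del: circ_cnj)
  also have "\<dots> = V - circ x" by simp
  also have "cnj q = 1 - cnj V * circ x" by (simp add: q_def)
  finally show ?thesis by (simp add: half_turn_def)
qed

lemma half_turn_half_turn:
  assumes "cmod V < 1" "cmod z = 1" shows "half_turn V (half_turn V z) = z"
proof -
  have d: "1 - cnj V * z \<noteq> 0"
    using one_minus_neq_0[of "cnj V" z] assms by simp
  have n: "1 - cnj V * V \<noteq> 0"
    using one_minus_neq_0[of "cnj V" V] assms by simp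
  have "V - half_turn V z = z * (1 - cnj V * V) / (1 - cnj V * z)"
    unfolding half_turn_def using d by (simp add: field_simps)
  moreover have "1 - cnj V * half_turn V z = (1 - cnj V * V) / (1 - cnj V * z)"
    unfolding half_turn_def using d by (simp add: field_simps)
  ultimately show ?thesis
    unfolding half_turn_def[of V "half_turn V z"] using d n by simp
qed

lemma continuous_chord_lift:
  assumes "cmod V < 1" shows "continuous_on UNIV (chord_lift V)"
proof -
  have "1 - V * cnj (circ x) \<notin> \<real>\<^sub>\<le>\<^sub>0" for x
    using Re_one_minus_pos[OF assms, of "cnj (circ x)"] by (auto simp: complex_nonpos_Reals_iff)
  moreover have "continuous_on UNIV circ"
    unfolding circ_def by (intro continuous_intros)
  ultimately show ?thesis unfolding chord_lift_def by (intro continuous_intros) auto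
qed

text \<open>The involution on the circle fixes \<open>f (f x) - x\<close> up to an integer, and the
  displacement bounds put that integer strictly between 0 and 2.\<close>

lemma half_turn_lift_chord_lift:
  assumes V: "cmod V < 1" shows "half_turn_lift (chord_lift V)"
proof -
  have "chord_lift V (chord_lift V x) = x + 1" for x
  proof -
    have "circ (chord_lift V (chord_lift V x)) = circ x"
      by (simp add: circ_chord_lift[OF V] half_turn_half_turn[OF V])
    then obtain k :: int where k: "chord_lift V (chord_lift V x) = x + of_int k"
      by (auto simp: circ_eq_iff)
    have "0 < real_of_int k" "real_of_int k < 2"
      using k chord_lift_bounds[OF V, of x] chord_lift_bounds[OF V, of "chord_lift V x"] by linarith+
    then have "k = 1" by linarith
    then show ?thesis using k by simp
  qed
  then show ?thesis
    using continuous_chord_lift[OF V] chord_lift_bounds[OF V] by (simp add: half_turn_lift_def)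
qed

text \<open>This factorization reduces the question on which side of a chord \<open>V\<close> lies
  to comparing \<open>s\<close> with the offset \<open>chord_lift V x - x\<close>.\<close>

lemma cross_chord:
  assumes V: "cmod V < 1"
  shows "cross (circ (x + s) - circ x) (V - circ x) =
    2 * cmod (1 - V * cnj (circ x)) * sin (pi * s) * sin (pi * (chord_lift V x - x - s))"
proof -
  define q where "q = 1 - V * cnj (circ x)"
  define \<theta> where "\<theta> = Arg q"
  have q: "q \<noteq> 0" using one_minus_neq_0[OF V] by (simp add: q_def)
  have q_polar: "Re q = cmod q * cos \<theta>" "Im q = cmod q * sin \<theta>"
    using cos_Arg[OF q] sin_Arg[OF q] q by (simp_all add: \<theta>_def)
  \<comment> \<open>The rotation by \<open>cnj (circ x)\<close> moves the base point of the chord to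
    1.\<close>
  have "cnj (circ (x + s) - circ x) * (V - circ x)
      = (cnj (circ s) - 1) * (V * cnj (circ x) - circ x * cnj (circ x))"
    by (simp add: circ_add algebra_simps del: circ_cnj)
  also have "\<dots> = (1 - cnj (circ s)) * q" by (simp add: q_def algebra_simps)
  finally have "cross (circ (x + s) - circ x) (V - circ x) = Im ((1 - cnj (circ s)) * q)"
    by (simp add: cross_def)
  also have "\<dots> = cmod q * ((1 - cos (2 * (pi * s))) * sin \<theta> + sin (2 * (pi * s)) * cos \<theta>)"
    unfolding q_polar by (simp add: circ_def q_polar algebra_simps)
  also have "(1 - cos (2 * (pi * s))) * sin \<theta> + sin (2 * (pi * s)) * cos \<theta>
      = 2 * sin (pi * s) * (sin (pi * s) * sin \<theta> + cos (pi * s) * cos \<theta>)"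
    unfolding cos_double_sin sin_double by (simp add: power2_eq_square algebra_simps)
  also have "sin (pi * s) * sin \<theta> + cos (pi * s) * cos \<theta> = cos (\<theta> - pi * s)"
    by (simp add: cos_diff)
  also have "\<dots> = sin (pi / 2 + (\<theta> - pi * s))" by (simp add: sin_add)
  also have "pi / 2 + (\<theta> - pi * s) = pi * (chord_lift V x - x - s)"
    unfolding chord_lift_def q_def[symmetric] \<theta>_def[symmetric] by (simp add: field_simps)
  finally show ?thesis by (simp add: q_def)
qed

lemma cross_chord_sgn:
  assumes V: "cmod V < 1" and s: "0 < s" "s < 1"
  shows "sgn (cross (circ (x + s) - circ x) (V - circ x)) = sgn (chord_lift V x - x - s)"
proof -
  define e where "e = chord_lift V x - x - s"
  have "1 - V * cnj (circ x) \<noteq> 0"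
    using one_minus_neq_0[OF V] by simp
  moreover have "sin (pi * s) > 0" using s by (intro sin_gt_zero) auto
  ultimately have "sgn (cross (circ (x + s) - circ x) (V - circ x)) = sgn (sin (pi * e))"
    unfolding cross_chord[OF V] e_def sgn_mult by simp
  also have "\<dots> = sgn e"
  proof -
    have e: "-1 < e" "e < 1" using chord_lift_bounds[OF V, of x] s by (auto simp: e_def)
    have "sin (pi * t) > 0" if "0 < t" "t < 1" for t using that by (intro sin_gt_zero) auto
    from this[of e] this[of "- e"] show ?thesis using e by (cases e "0::real" rule: linorder_cases) auto
  qed
  finally show ?thesis by (simp add: e_def)
qed

section \<open>Half-planes and supporting lines\<close>

lemma cross_scale_right: "cross a (of_real t * b) = t * cross a b"
  by (simp add: cross_def algebra_simps)

lemma on_line_iff_cross: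
  assumes "a \<noteq> b" shows "on_line a b v \<longleftrightarrow> cross (b - a) (v - a) = 0"
proof
  assume "on_line a b v"
  then obtain t where "v = a + of_real t * (b - a)" by (auto simp: on_line_def)
  then have "cross (b - a) (v - a) = t * cross (b - a) (b - a)" by (simp add: cross_scale_right)
  also have "cross (b - a) (b - a) = 0" by (simp add: cross_def algebra_simps)
  finally show "cross (b - a) (v - a) = 0" by simp
next
  assume c: "cross (b - a) (v - a) = 0"
  define w where "w = cnj (b - a) * (v - a)"
  have "w = of_real (Re w)" using c by (simp add: cross_def w_def complex_eq_iff)
  moreover have "v - a = w / (cnj (b - a) * (b - a)) * (b - a)"
    using assms by (simp add: w_def)
  moreover have "cnj (b - a) * (b - a) = of_real ((cmod (b - a))\<^sup>2)"
    using complex_norm_square[of "b - a"] by (simp add: mult.commute)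
  ultimately have "v - a = of_real (Re w) / of_real ((cmod (b - a))\<^sup>2) * (b - a)" by metis
  then have "v - a = of_real (Re w / (cmod (b - a))\<^sup>2) * (b - a)" by (simp only: of_real_divide)
  then have "v = a + of_real (Re w / (cmod (b - a))\<^sup>2) * (b - a)" by (simp add: algebra_simps)
  then show "on_line a b v" unfolding on_line_def by blast
qed

lemma convex_cross_pos: "convex {v. cross d (v - a) > 0}"
  and convex_cross_nonneg: "convex {v. cross d (v - a) \<ge> 0}"
proof -
  have "cross d (v - a) = inner (\<i> * d) v - inner (\<i> * d) a" for v
    by (simp add: cross_def inner_complex_def algebra_simps)
  then have "{v. cross d (v - a) > 0} = {v. inner (\<i> * d) v > inner (\<i> * d) a}"
    "{v. cross d (v - a) \<ge> 0} = {v. inner (\<i> * d) v \<ge> inner (\<i> * d) a}" by auto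
  then show "convex {v. cross d (v - a) > 0}" "convex {v. cross d (v - a) \<ge> 0}"
    by (simp_all add: convex_halfspace_gt convex_halfspace_ge)
qed

lemma cross_minus_left: "cross (- d) v = - cross d v"
  by (simp add: cross_def)

text \<open>Sign conditions pass from the vertices to the hull because half-planes are convex. If
  the line missed all vertices, an open half-plane would contain the hull and the line would miss
  the triangle.\<close>

lemma supports_triangle_iff:
  assumes "a \<noteq> b"
  shows "supports a b (triangle P Q R) \<longleftrightarrow>
    (\<exists>v\<in>{P, Q, R}. cross (b - a) (v - a) = 0) \<and>
    ((\<forall>v\<in>{P, Q, R}. cross (b - a) (v - a) \<ge> 0) \<or> (\<forall>v\<in>{P, Q, R}. cross (b - a) (v - a) \<le> 0))"
    (is "?L \<longleftrightarrow> ?R")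
proof -
  define c where "c v = cross (b - a) (v - a)" for v
  have vert: "{P, Q, R} \<subseteq> triangle P Q R" by (simp add: triangle_def hull_subset)
  have hull: "\<forall>v\<in>triangle P Q R. p v" if "convex {v. p v}" "\<forall>v\<in>{P, Q, R}. p v" for p
  proof -
    have "triangle P Q R \<subseteq> {v. p v}"
      unfolding triangle_def by (rule hull_minimal) (use that in auto)
    then show ?thesis by auto
  qed
  have conv: "convex {v. c v \<ge> 0}" "convex {v. c v > 0}" "convex {v. c v \<le> 0}" "convex {v. c v < 0}"
    unfolding c_def
    using convex_cross_nonneg[of "b - a" a] convex_cross_nonneg[of "- (b - a)" a]
      convex_cross_pos[of "b - a" a] convex_cross_pos[of "- (b - a)" a]
    by (simp_all only: cross_minus_left neg_0_le_iff_le neg_0_less_iff_less)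
  have ge: "(\<forall>v\<in>triangle P Q R. c v \<ge> 0) \<longleftrightarrow> (\<forall>v\<in>{P, Q, R}. c v \<ge> 0)"
    by (intro iffI hull[OF conv(1)]) (use vert in blast)+
  have le: "(\<forall>v\<in>triangle P Q R. c v \<le> 0) \<longleftrightarrow> (\<forall>v\<in>{P, Q, R}. c v \<le> 0)"
    by (intro iffI hull[OF conv(3)]) (use vert in blast)+
  have "?L \<longleftrightarrow> (\<exists>v\<in>triangle P Q R. c v = 0) \<and>
      ((\<forall>v\<in>triangle P Q R. c v \<ge> 0) \<or> (\<forall>v\<in>triangle P Q R. c v \<le> 0))"
    by (simp add: supports_def on_line_iff_cross[OF assms] c_def assms)
  then have sup: "?L \<longleftrightarrow> (\<exists>v\<in>triangle P Q R. c v = 0) \<and>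
      ((\<forall>v\<in>{P, Q, R}. c v \<ge> 0) \<or> (\<forall>v\<in>{P, Q, R}. c v \<le> 0))"
    by (simp only: ge le)
  have "(\<exists>v\<in>{P, Q, R}. c v = 0)"
    if z: "\<exists>v\<in>triangle P Q R. c v = 0"
      and s: "(\<forall>v\<in>{P, Q, R}. c v \<ge> 0) \<or> (\<forall>v\<in>{P, Q, R}. c v \<le> 0)"
  proof (rule ccontr)
    assume "\<not> ?thesis"
    then have "(\<forall>v\<in>{P, Q, R}. c v > 0) \<or> (\<forall>v\<in>{P, Q, R}. c v < 0)"
      using s by (auto simp: order.order_iff_strict)
    then show False
    proof
      assume "\<forall>v\<in>{P, Q, R}. c v > 0"
      from hull[OF conv(2) this] z show False by fastforce
    next
      assume "\<forall>v\<in>{P, Q, R}. c v < 0"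
      from hull[OF conv(4) this] z show False by fastforce
    qed
  qed
  moreover have "\<exists>v\<in>triangle P Q R. c v = 0" if "\<exists>v\<in>{P, Q, R}. c v = 0"
    using that vert by (meson subsetD)
  ultimately show ?thesis unfolding sup c_def[symmetric] by argo
qed

lemma circ_add_neq: "0 < s \<Longrightarrow> s < 1 \<Longrightarrow> circ x \<noteq> circ (x + s)"
proof
  assume s: "0 < s" "s < 1" and "circ x = circ (x + s)"
  then obtain k :: int where "x = x + s + of_int k" unfolding circ_eq_iff by blast
  then have "s = - of_int k" by simp
  then have "0 < - k" "- k < 1" using s by linarith+
  then show False by simp
qed

text \<open>A supporting offset is one of the three vertex offsets and lies on one side of the
  others. The least of the three has this property, so it is the \<open>Min\<close>.\<close>

lemma psi_triangle:
  assumes "cmod P < 1" "cmod Q < 1" "cmod R < 1"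
  shows "psi (triangle P Q R) x
    = proj (min (chord_lift P x) (min (chord_lift Q x) (chord_lift R x)))"
proof -
  define s where "s V = chord_lift V x - x" for V
  define m where "m = min (s P) (min (s Q) (s R))"
  define S where "S = {t \<in> {0<..<1}. supports (circ x) (circ (x + t)) (triangle P Q R)}"
  have disk: "cmod V < 1" if "V \<in> {P, Q, R}" for V using that assms by auto
  have s01: "0 < s V" "s V < 1" if "V \<in> {P, Q, R}" for V
    using chord_lift_bounds[OF disk[OF that], of x] by (auto simp: s_def)
  have sg: "sgn (cross (circ (x + t) - circ x) (V - circ x)) = sgn (s V - t)"
    if "0 < t" "t < 1" "V \<in> {P, Q, R}" for t V
    using cross_chord_sgn[OF disk] that by (simp add: s_def)
  have sgns: "cross (circ (x + t) - circ x) (V - circ x) = 0 \<longleftrightarrow> t = s V"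
    "cross (circ (x + t) - circ x) (V - circ x) \<ge> 0 \<longleftrightarrow> t \<le> s V"
    "cross (circ (x + t) - circ x) (V - circ x) \<le> 0 \<longleftrightarrow> t \<ge> s V"
    if "0 < t" "t < 1" "V \<in> {P, Q, R}" for t V
    using sg[OF that] by (auto simp: sgn_if split: if_splits)
  have S: "t \<in> S \<longleftrightarrow> 0 < t \<and> t < 1 \<and> (\<exists>v\<in>{P, Q, R}. t = s v) \<and>
      ((\<forall>v\<in>{P, Q, R}. t \<le> s v) \<or> (\<forall>v\<in>{P, Q, R}. t \<ge> s v))" for t
    unfolding S_def using supports_triangle_iff[OF circ_add_neq[of t x], of P Q R] sgns[of t]
    by (auto)
  have "Min S = m"
  proof (rule Min_eqI)
    have "S \<subseteq> s ` {P, Q, R}" using S by blast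
    then show "finite S" by (rule finite_subset) simp
    show "m \<le> t" if "t \<in> S" for t using that S[of t] by (auto simp: m_def)
    have "m = s P \<or> m = s Q \<or> m = s R" by (auto simp: m_def min_def)
    then obtain v where v: "v \<in> {P, Q, R}" "m = s v" by blast
    have "\<forall>v\<in>{P, Q, R}. m \<le> s v" by (simp add: m_def min_le_iff_disj)
    then show "m \<in> S" using v s01[OF v(1)] S[of m] by blast
  qed
  then show ?thesis
    unfolding psi_def S_def[symmetric] by (simp add: m_def s_def min_add_distrib_right[symmetric] min_def)
qed

section \<open>The lift of the triangle map\<close>

lemma proj_eq_iff: "proj x = proj y \<longleftrightarrow> (\<exists>k::int. x = y + of_int k)"
proof
  assume "proj x = proj y"
  then have "x = y + of_int (\<lfloor>x\<rfloor> - \<lfloor>y\<rfloor>)" by (simp add: proj_def)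
  then show "\<exists>k::int. x = y + of_int k" by blast
qed (auto simp: proj_def)

text \<open>The difference is continuous with integer values, hence constant, and at 0 it is less
  than 1 in absolute value. This justifies the \<open>THE\<close> in
  \<open>psi_lift\<close>.\<close>

lemma continuous_lift_unique:
  fixes F G :: "real \<Rightarrow> real"
  assumes "continuous_on UNIV F" "continuous_on UNIV G" "\<And>x. proj (F x) = proj (G x)"
    and "0 < F 0" "F 0 < 1" "0 < G 0" "G 0 < 1"
  shows "F = G"
proof -
  let ?d = "\<lambda>x. F x - G x"
  have int: "?d x \<in> \<int>" for x
    using assms(3)[of x] by (auto simp: proj_eq_iff)
  have "?d constant_on UNIV"
  proof (rule continuous_discrete_range_constant)
    show "continuous_on UNIV ?d" by (intro continuous_intros assms)
    show "\<exists>e>0. \<forall>y. y \<in> UNIV \<and> ?d y \<noteq> ?d x \<longrightarrow> e \<le> norm (?d y - ?d x)" for x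
    proof (intro exI[of _ 1] conjI allI impI)
      fix y assume y: "y \<in> UNIV \<and> ?d y \<noteq> ?d x"
      have "?d y - ?d x \<in> \<int>" by (rule Ints_diff[OF int int])
      then show "1 \<le> norm (?d y - ?d x)" using y Ints_nonzero_abs_ge1[of "?d y - ?d x"] by auto
    qed simp
  qed (rule connected_UNIV)
  then obtain c where c: "\<And>x. ?d x = c" by (auto simp: constant_on_def)
  have "c \<in> \<int>" using int[of 0] c[of 0] by simp
  moreover have "\<bar>c\<bar> < 1" using c[of 0] assms by linarith
  ultimately have "c = 0" using Ints_nonzero_abs_ge1 by force
  then show ?thesis using c by (auto simp: fun_eq_iff)
qed

lemma psi_lift_triangle:
  assumes "cmod P < 1" "cmod Q < 1" "cmod R < 1"
  shows "psi_lift (triangle P Q R)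
    = (\<lambda>x. min (chord_lift P x) (min (chord_lift Q x) (chord_lift R x)))"
proof -
  define G where "G x = min (chord_lift P x) (min (chord_lift Q x) (chord_lift R x))" for x
  have cont: "continuous_on UNIV G"
    unfolding G_def by (intro continuous_intros continuous_chord_lift assms)
  have G0: "0 < G 0" "G 0 < 1"
    using assms[THEN chord_lift_bounds(1), of 0] assms[THEN chord_lift_bounds(2), of 0]
    by (auto simp: G_def)
  have "proj (G x) = psi (triangle P Q R) (proj x)" for x
  proof -
    have "proj x = x + of_int (- \<lfloor>x\<rfloor>)" by (simp add: proj_def)
    then have "circ (proj x) = circ x" unfolding circ_eq_iff by blast
    then have "chord_lift V (proj x) = chord_lift V x - of_int \<lfloor>x\<rfloor>" for V
      by (simp add: chord_lift_def proj_def)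
    then have "G (proj x) = G x - of_int \<lfloor>x\<rfloor>" by (simp add: G_def min_def)
    then have "G (proj x) = G x + of_int (- \<lfloor>x\<rfloor>)" by simp
    then have "proj (G (proj x)) = proj (G x)" unfolding proj_eq_iff by blast
    then show ?thesis using psi_triangle[OF assms, of "proj x"] by (simp add: G_def)
  qed
  then have "psi_lift (triangle P Q R) = G"
    unfolding psi_lift_def
    by (intro the_equality) (use cont G0 in \<open>auto intro!: continuous_lift_unique\<close>)
  then show ?thesis by (simp add: G_def fun_eq_iff)
qed

text \<open>A common offset \<open>s\<close> puts all three points on the chord from
  \<open>circ x\<close> to \<open>circ (x + s)\<close>.\<close>

lemma chord_lift_collinear:
  assumes "cmod P < 1" "cmod Q < 1" "cmod R < 1"
    and "chord_lift P x = chord_lift Q x" "chord_lift Q x = chord_lift R x"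
  shows "collinear {P, Q, R}"
proof -
  define s where "s = chord_lift P x - x"
  have s: "0 < s" "s < 1" using chord_lift_bounds[OF assms(1), of x] by (auto simp: s_def)
  have "on_line (circ x) (circ (x + s)) V" if "V \<in> {P, Q, R}" for V
  proof -
    have "cmod V < 1" "chord_lift V x - x - s = 0" using that assms by (auto simp: s_def)
    then show ?thesis
      using cross_chord_sgn[OF _ s, of V x] on_line_iff_cross[OF circ_add_neq[OF s], of x V]
      by (simp add: sgn_zero_iff)
  qed
  then have "\<exists>t. V = circ x + t *\<^sub>R (circ (x + s) - circ x)" if "V \<in> {P, Q, R}" for V
    using that by (auto simp: on_line_def scaleR_conv_of_real)
  then show ?thesis unfolding collinear_alt by blast
qed

lemma three_half_turns_chord_lift:
  assumes "cmod P < 1" "cmod Q < 1" "cmod R < 1" "\<not> collinear {P, Q, R}"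
  shows "three_half_turns (chord_lift P) (chord_lift Q) (chord_lift R)"
  using assms chord_lift_collinear half_turn_lift_chord_lift by unfold_locales blast+

section \<open>Products of three half-turns\<close>

lemma cross_diff_eq: "cross (Q - P) (R - P) = cross P Q + cross Q R + cross R P"
  by (simp add: cross_def algebra_simps)

text \<open>As \<open>z\<close> runs over the circle, \<open>Re (cnj v * z)\<close> sweeps the
  interval from \<open>- cmod v\<close> to \<open>cmod v\<close>.\<close>

lemma unit_linear_equation_solvable:
  "(\<exists>z. cmod z = 1 \<and> a + Re (cnj v * z) = 0) \<longleftrightarrow> \<bar>a\<bar> \<le> cmod v"
proof
  assume "\<exists>z. cmod z = 1 \<and> a + Re (cnj v * z) = 0"
  then obtain z where z: "cmod z = 1" "a = - Re (cnj v * z)" by auto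
  have "\<bar>a\<bar> \<le> cmod (cnj v * z)" using abs_Re_le_cmod[of "cnj v * z"] z(2) by simp
  then show "\<bar>a\<bar> \<le> cmod v" using z(1) by (simp add: norm_mult)
next
  assume le: "\<bar>a\<bar> \<le> cmod v"
  show "\<exists>z. cmod z = 1 \<and> a + Re (cnj v * z) = 0"
  proof (cases "v = 0")
    case True
    then show ?thesis using le by (intro exI[of _ 1]) simp
  next
    case False
    define t where "t = arccos (- a / cmod v)"
    have "cos t = - a / cmod v"
      unfolding t_def using le False by (intro cos_arccos) (auto simp: field_simps abs_le_iff)
    moreover have "Re (cnj v * (sgn v * cis t)) = cmod v * cos t"
    proof -
      have "cnj v * sgn v = of_real (cmod v)"
        using complex_norm_square[of v] False
        by (simp add: sgn_eq field_simps power2_eq_square)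
      then have "cnj v * (sgn v * cis t) = of_real (cmod v) * cis t" by (simp only: mult.assoc[symmetric])
      then show ?thesis by (simp only: times_complex.sel) simp
    qed
    ultimately have "a + Re (cnj v * (sgn v * cis t)) = 0"
      using False by (simp only:) simp
    moreover have "cmod (sgn v * cis t) = 1" using False by (simp add: norm_mult norm_sgn)
    ultimately show ?thesis by blast
  qed
qed

text \<open>The product of the three matrices has trace \<open>2 \<i> cross (B - A) (C - A)\<close> and determinant minus
  the product of the \<open>1 - (cmod V)\<^sup>2\<close>, so this is the criterion for it not to be elliptic.\<close>
lemma half_turn_triple_fixed_iff:
  assumes A: "cmod A < 1" and B: "cmod B < 1" and C: "cmod C < 1"
  shows "(\<exists>z. cmod z = 1 \<and> half_turn C (half_turn B (half_turn A z)) = z) \<longleftrightarrow>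
    (1 - (cmod A)\<^sup>2) * (1 - (cmod B)\<^sup>2) * (1 - (cmod C)\<^sup>2) \<le> (cross (B - A) (C - A))\<^sup>2"
proof -
  \<comment> \<open>\<open>u\<close> and \<open>v\<close> form the top row of the product of the
    matrices with rows \<open>(-1, V)\<close> and \<open>(- cnj V, 1)\<close>, that of
    \<open>A\<close> acting first. The bottom row is \<open>(- cnj v, - cnj u)\<close>, which gives
    \<open>d3\<close>.\<close>
  define u where "u = -1 + B * cnj A + C * cnj B - C * cnj A"
  define v where "v = A - B + C - C * cnj B * A"
  have fixed: "half_turn C (half_turn B (half_turn A z)) = z \<longleftrightarrow> Re u + Re (cnj v * z) = 0"
    if z: "cmod z = 1" for z
  proof -
    define d1 where "d1 = 1 - cnj A * z"
    define d2 where "d2 = (1 - cnj B * A) + (cnj B - cnj A) * z"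
    define d3 where "d3 = - (cnj u + cnj v * z)"
    have unit: "cmod (half_turn V w) = 1" if "cmod V < 1" "cmod w = 1" for V w
      using circ_chord_lift[OF that(1)] circ_surj[OF that(2)] norm_circ by metis
    have nz: "1 - cnj V * w \<noteq> 0" if "cmod V < 1" "cmod w = 1" for V w
      using one_minus_neq_0[of "cnj V" w] that by simp
    have d1: "d1 \<noteq> 0" using nz[OF A z] by (simp add: d1_def)
    have h1: "half_turn A z = (A - z) / d1" by (simp add: half_turn_def d1_def)
    have "1 - cnj B * half_turn A z = d2 / d1"
      unfolding h1 using d1 by (simp add: field_simps) (simp add: d1_def d2_def algebra_simps)
    moreover from this have d2: "d2 \<noteq> 0" using nz[OF B unit[OF A z]] by auto
    moreover have "B - half_turn A z = ((B - A) + (1 - B * cnj A) * z) / d1"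
      unfolding h1 using d1 by (simp add: field_simps) (simp add: d1_def algebra_simps)
    ultimately have h2: "half_turn B (half_turn A z) = ((B - A) + (1 - B * cnj A) * z) / d2"
      unfolding half_turn_def[of B] using d1 by simp
    have "1 - cnj C * half_turn B (half_turn A z) = d3 / d2"
      unfolding h2 using d2 by (simp add: field_simps) (simp add: d3_def d2_def u_def v_def algebra_simps)
    moreover from this have d3: "d3 \<noteq> 0" using nz[OF C unit[OF B unit[OF A z]]] by auto
    moreover have "C - half_turn B (half_turn A z) = (u * z + v) / d2"
      unfolding h2 using d2 by (simp add: field_simps) (simp add: d2_def u_def v_def algebra_simps)
    ultimately have "half_turn C (half_turn B (half_turn A z)) = (u * z + v) / d3"
      unfolding half_turn_def[of C] using d2 by simp
    then have "half_turn C (half_turn B (half_turn A z)) = z \<longleftrightarrow> u * z + v = z * d3"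
      using d3 by (simp add: divide_eq_eq)
    \<comment> \<open>Since \<open>cnj z\<close> is the inverse of \<open>z\<close>, this factor
      turns the quadratic fixed point equation into a real linear condition.\<close>
    also have "\<dots> \<longleftrightarrow> cnj z * (u * z + v - z * d3) = 0" using z by auto
    also have "cnj z * (u * z + v - z * d3) = (z * cnj z) * (u + cnj u + cnj v * z) + cnj z * v"
      by (simp add: d3_def algebra_simps)
    also have "\<dots> = (u + cnj u) + (cnj v * z + cnj (cnj v * z))"
      using complex_norm_square[of z] z by (simp add: algebra_simps)
    also have "\<dots> = of_real (2 * (Re u + Re (cnj v * z)))"
      by (simp only: complex_add_cnj of_real_add distrib_left)
    finally show ?thesis by (simp only: of_real_eq_0_iff mult_eq_0_iff) simp
  qed
  have "(\<exists>z. cmod z = 1 \<and> half_turn C (half_turn B (half_turn A z)) = z) \<longleftrightarrow> \<bar>Re u\<bar> \<le> cmod v"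
    using fixed unit_linear_equation_solvable[of "Re u" v] by auto
  also have "\<dots> \<longleftrightarrow> (Re u)\<^sup>2 \<le> (cmod v)\<^sup>2"
    by (metis abs_norm_cancel abs_le_square_iff)
  also have "\<dots> \<longleftrightarrow> (1 - (cmod A)\<^sup>2) * (1 - (cmod B)\<^sup>2) * (1 - (cmod C)\<^sup>2) \<le> (Im u)\<^sup>2"
  proof -
    \<comment> \<open>Multiplicativity of the determinant, written out.\<close>
    have "(Re u)\<^sup>2 + (Im u)\<^sup>2 - (cmod v)\<^sup>2 = (1 - (cmod A)\<^sup>2) * (1 - (cmod B)\<^sup>2) * (1 - (cmod C)\<^sup>2)"
      unfolding cmod_power2 u_def v_def by simp algebra
    then show ?thesis by linarith
  qed
  also have "Im u = cross (B - A) (C - A)"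
    unfolding cross_diff_eq by (simp add: u_def cross_def algebra_simps)
  finally show ?thesis .
qed

section \<open>The Klein metric\<close>

lemma inner_self_less_1: "cmod V < 1 \<Longrightarrow> V \<bullet> V < 1"
  by (simp add: dot_square_norm power_less_one_iff)

text \<open>\<open>t1\<close> and \<open>t2\<close> are the roots of the quadratic
  \<open>(cmod (P + t * (Q - P)))\<^sup>2 - 1\<close>. The identities express its values at 0 and 1
  and its polar form through the roots, as the distance formula requires.\<close>

lemma chord_ends_param:
  assumes P: "cmod P < 1" and Q: "cmod Q < 1" and ne: "P \<noteq> Q"
  obtains t1 t2 where "t1 < 0" "1 < t2"
    "chord_ends P Q = {P + of_real t1 * (Q - P), P + of_real t2 * (Q - P)}"
    "(cmod (Q - P))\<^sup>2 * (- t1 * t2) = 1 - P \<bullet> P"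
    "(cmod (Q - P))\<^sup>2 * ((1 - t1) * (t2 - 1)) = 1 - Q \<bullet> Q"
    "(cmod (Q - P))\<^sup>2 * (t1 + t2 - 2 * t1 * t2) = 2 * (1 - P \<bullet> Q)"
proof -
  define a where "a = (cmod (Q - P))\<^sup>2"
  define b where "b = P \<bullet> (Q - P)"
  define p where "p = 1 - P \<bullet> P"
  have a: "a > 0" using ne by (simp add: a_def)
  have p: "p > 0" using inner_self_less_1[OF P] by (simp add: p_def)
  have q: "1 - Q \<bullet> Q > 0" using inner_self_less_1[OF Q] by simp
  have aeq: "a = Q \<bullet> Q - 2 * (P \<bullet> Q) + P \<bullet> P"
    by (simp add: a_def power2_norm_eq_inner inner_diff inner_commute)
  have beq: "b = P \<bullet> Q - P \<bullet> P" by (simp add: b_def inner_diff)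
  define D where "D = sqrt (b\<^sup>2 + a * p)"
  have D2: "D\<^sup>2 = b\<^sup>2 + a * p" unfolding D_def using a p by simp
  have Db: "D > \<bar>b\<bar>" unfolding D_def using a p by (intro real_less_rsqrt) simp
  define t1 t2 where "t1 = (- b - D) / a" and "t2 = (- b + D) / a"
  have prod: "a * (t1 * t2) = - p"
  proof -
    have "a * (a * (t1 * t2)) = (- b - D) * (- b + D)" using a by (simp add: t1_def t2_def)
    also have "\<dots> = a * (- p)" using D2 by (simp add: algebra_simps power2_eq_square)
    finally show ?thesis using a by (simp only: mult_cancel_left) simp
  qed
  have sum: "a * (t1 + t2) = - 2 * b" using a by (simp add: t1_def t2_def field_simps)
  have quad: "a * t\<^sup>2 + 2 * b * t - p = a * ((t - t1) * (t - t2))" for t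
    using prod sum by (simp add: power2_eq_square algebra_simps) algebra
  have t1: "t1 < 0" using Db a by (simp add: t1_def divide_neg_pos)
  have q1: "a * ((1 - t1) * (1 - t2)) = - (1 - Q \<bullet> Q)"
    using quad[of 1] by (simp add: aeq beq p_def)
  \<comment> \<open>The quadratic is negative at 1 because \<open>Q\<close> is in the disk, so 1
    lies between the roots.\<close>
  have t2: "t2 > 1"
  proof (rule ccontr)
    assume "\<not> ?thesis"
    then have "a * ((1 - t1) * (1 - t2)) \<ge> 0" using t1 a by simp
    then show False using q1 q by simp
  qed
  have norm: "cmod (P + of_real t * (Q - P)) = 1 \<longleftrightarrow> t = t1 \<or> t = t2" for t
  proof -
    have "(cmod (P + of_real t * (Q - P)))\<^sup>2 - 1 = a * t\<^sup>2 + 2 * b * t - p"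
      unfolding a_def b_def p_def cmod_power2
      by (simp add: inner_complex_def power2_eq_square algebra_simps)
    also have "\<dots> = a * ((t - t1) * (t - t2))" by (rule quad)
    finally have "(cmod (P + of_real t * (Q - P)))\<^sup>2 = 1 \<longleftrightarrow> t = t1 \<or> t = t2" using a by auto
    then show ?thesis by (simp only: abs_square_eq_1 abs_norm_cancel)
  qed
  have ends: "chord_ends P Q = {P + of_real t1 * (Q - P), P + of_real t2 * (Q - P)}"
    unfolding chord_ends_def on_line_def using norm by auto
  show ?thesis
  proof (rule that[OF t1 t2 ends])
    show "(cmod (Q - P))\<^sup>2 * (- t1 * t2) = 1 - P \<bullet> P"
      using prod by (simp add: a_def p_def)
    show "(cmod (Q - P))\<^sup>2 * ((1 - t1) * (t2 - 1)) = 1 - Q \<bullet> Q"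
      using q1 unfolding a_def by (simp add: algebra_simps)
    show "(cmod (Q - P))\<^sup>2 * (t1 + t2 - 2 * t1 * t2) = 2 * (1 - P \<bullet> Q)"
      using prod sum unfolding a_def[symmetric] by (simp add: p_def beq algebra_simps)
  qed
qed

lemma sinh_half_ln_squared:
  fixes r :: real
  assumes "r > 0" shows "(sinh (\<bar>ln r\<bar> / 2))\<^sup>2 = (r - 1)\<^sup>2 / (4 * r)"
proof -
  have "(sinh (\<bar>ln r\<bar> / 2))\<^sup>2 = (sinh (ln r / 2))\<^sup>2"
    by (cases "ln r \<ge> 0") (simp_all add: abs_if)
  also have "ln r / 2 = ln (sqrt r)" using assms by (simp add: ln_sqrt)
  also have "sinh (ln (sqrt r)) = (sqrt r - inverse (sqrt r)) / 2" using assms by (simp add: sinh_ln_real)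
  also have "\<dots> = (r - 1) / (2 * sqrt r)" using assms by (simp add: field_simps)
  also have "\<dots>\<^sup>2 = (r - 1)\<^sup>2 / (4 * r)" using assms by (simp add: power_divide power_mult_distrib)
  finally show ?thesis .
qed

text \<open>This is the hyperboloid formula for the distance in terms of the Minkowski products of
  \<open>(1, P)\<close> and \<open>(1, Q)\<close>. With the cross ratio \<open>r = n / m\<close>, it
  rests on \<open>(n - m)\<^sup>2 = (n + m)\<^sup>2 - 4 * n * m\<close>.\<close>

lemma sinh_dprime_squared:
  assumes P: "cmod P < 1" and Q: "cmod Q < 1" and ne: "P \<noteq> Q"
  shows "(sinh (dprime P Q))\<^sup>2 = ((1 - P \<bullet> Q)\<^sup>2 - (1 - P \<bullet> P) * (1 - Q \<bullet> Q)) / ((1 - P \<bullet> P) * (1 - Q \<bullet> Q))"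
    and "dprime P Q \<ge> 0"
proof -
  obtain t1 t2 where t1: "t1 < 0" and t2: "1 < t2"
    and ends: "chord_ends P Q = {P + of_real t1 * (Q - P), P + of_real t2 * (Q - P)}"
    and eP: "(cmod (Q - P))\<^sup>2 * (- t1 * t2) = 1 - P \<bullet> P"
    and eQ: "(cmod (Q - P))\<^sup>2 * ((1 - t1) * (t2 - 1)) = 1 - Q \<bullet> Q"
    and ePQ: "(cmod (Q - P))\<^sup>2 * (t1 + t2 - 2 * t1 * t2) = 2 * (1 - P \<bullet> Q)"
    using chord_ends_param[OF assms] .
  define w where "w t = P + of_real t * (Q - P)" for t
  define l where "l = cmod (Q - P)"
  have l: "l > 0" using ne by (simp add: l_def)
  have dP: "dist (w t) P = \<bar>t\<bar> * l" for t by (simp add: w_def dist_norm norm_mult l_def)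
  have dQ: "dist (w t) Q = \<bar>1 - t\<bar> * l" for t
  proof -
    have "w t - Q = of_real (t - 1) * (Q - P)" by (simp add: w_def algebra_simps)
    then show ?thesis by (simp add: dist_norm norm_mult l_def abs_minus_commute del: of_real_diff)
  qed
  define r where "r = ((1 - t1) * t2) / (- t1 * (t2 - 1))"
  have r: "r > 0" unfolding r_def using t1 t2 by (intro divide_pos_pos mult_pos_pos) auto
  have r1: "(dist (w t1) Q * dist (w t2) P) / (dist (w t1) P * dist (w t2) Q) = r"
    unfolding dP dQ r_def using t1 t2 l by (simp add: field_simps)
  have r2: "(dist (w t2) Q * dist (w t1) P) / (dist (w t2) P * dist (w t1) Q) = inverse r"
    unfolding r1[symmetric] by (simp add: mult.commute)
  have neq: "w t1 \<noteq> w t2" using t1 t2 ne by (auto simp: w_def)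
  have ends: "chord_ends P Q = {w t1, w t2}" using ends by (simp add: w_def)
  have d: "dprime P Q = \<bar>ln r\<bar> / 2"
  proof -
    \<comment> \<open>The two labellings of the ends give \<open>r\<close> and its inverse, so
      \<open>SOME\<close> has only one candidate.\<close>
    have "(\<exists>v1 v2. v1 \<noteq> v2 \<and> chord_ends P Q = {v1, v2} \<and>
        x = \<bar>ln ((dist v1 Q * dist v2 P) / (dist v1 P * dist v2 Q))\<bar> / 2) \<longleftrightarrow> x = \<bar>ln r\<bar> / 2" for x
    proof
      assume "\<exists>v1 v2. v1 \<noteq> v2 \<and> chord_ends P Q = {v1, v2} \<and>
        x = \<bar>ln ((dist v1 Q * dist v2 P) / (dist v1 P * dist v2 Q))\<bar> / 2"
      then obtain v1 v2 where v: "{w t1, w t2} = {v1, v2}"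
        and x: "x = \<bar>ln ((dist v1 Q * dist v2 P) / (dist v1 P * dist v2 Q))\<bar> / 2"
        unfolding ends by blast
      from v consider "v1 = w t1" "v2 = w t2" | "v1 = w t2" "v2 = w t1"
        by (auto simp: doubleton_eq_iff)
      then show "x = \<bar>ln r\<bar> / 2"
      proof cases
        case 1 then show ?thesis using x r1 by simp
      next
        case 2 then show ?thesis using x r2 r by (simp add: ln_inverse)
      qed
    next
      assume "x = \<bar>ln r\<bar> / 2"
      then show "\<exists>v1 v2. v1 \<noteq> v2 \<and> chord_ends P Q = {v1, v2} \<and>
        x = \<bar>ln ((dist v1 Q * dist v2 P) / (dist v1 P * dist v2 Q))\<bar> / 2"
        using neq ends r1 by (intro exI[of _ "w t1"] exI[of _ "w t2"]) simp
    qed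
    then show ?thesis unfolding dprime_def using ne by (simp only: if_False some_eq_trivial)
  qed
  then show "dprime P Q \<ge> 0" by simp
  define n where "n = (1 - t1) * t2"
  define m where "m = - t1 * (t2 - 1)"
  have nm: "n > 0" "m > 0" unfolding n_def m_def using t1 t2 by (auto intro!: mult_pos_pos mult_neg_pos)
  have r_eq: "r = n / m" by (simp add: r_def n_def m_def)
  have "(r - 1)\<^sup>2 / (4 * r) = ((n + m)\<^sup>2 - 4 * (n * m)) / (4 * (n * m))"
    unfolding r_eq using nm by (simp add: field_simps power2_eq_square)
  \<comment> \<open>Numerator and denominator are homogeneous in \<open>n\<close> and
    \<open>m\<close>; scaling both by \<open>l\<^sup>2\<close> makes the identities of the chord
    parameters applicable.\<close>
  also have "\<dots> = ((l\<^sup>2 * (n + m))\<^sup>2 - 4 * ((l\<^sup>2)\<^sup>2 * (n * m))) / (4 * ((l\<^sup>2)\<^sup>2 * (n * m)))"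
  proof -
    have "(l\<^sup>2 * (n + m))\<^sup>2 - 4 * ((l\<^sup>2)\<^sup>2 * (n * m)) = (l\<^sup>2)\<^sup>2 * ((n + m)\<^sup>2 - 4 * (n * m))"
      "4 * ((l\<^sup>2)\<^sup>2 * (n * m)) = (l\<^sup>2)\<^sup>2 * (4 * (n * m))"
      by algebra+
    then show ?thesis using l by simp
  qed
  also have "l\<^sup>2 * (n + m) = 2 * (1 - P \<bullet> Q)"
    using ePQ by (simp add: l_def n_def m_def algebra_simps)
  also have "(l\<^sup>2)\<^sup>2 * (n * m) = (l\<^sup>2 * (- t1 * t2)) * (l\<^sup>2 * ((1 - t1) * (t2 - 1)))"
    by (simp add: n_def m_def power2_eq_square mult_ac)
  also have "\<dots> = (1 - P \<bullet> P) * (1 - Q \<bullet> Q)" using eP eQ by (simp only: l_def)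
  also have "((2 * (1 - P \<bullet> Q))\<^sup>2 - 4 * ((1 - P \<bullet> P) * (1 - Q \<bullet> Q))) / (4 * ((1 - P \<bullet> P) * (1 - Q \<bullet> Q)))
     = ((1 - P \<bullet> Q)\<^sup>2 - (1 - P \<bullet> P) * (1 - Q \<bullet> Q)) / ((1 - P \<bullet> P) * (1 - Q \<bullet> Q))"
  proof -
    have "(2 * x)\<^sup>2 - 4 * y = 4 * (x\<^sup>2 - y)" for x y :: real by algebra
    then show ?thesis by (simp only: mult_divide_mult_cancel_left_if) simp
  qed
  finally show "(sinh (dprime P Q))\<^sup>2 = ((1 - P \<bullet> Q)\<^sup>2 - (1 - P \<bullet> P) * (1 - Q \<bullet> Q)) / ((1 - P \<bullet> P) * (1 - Q \<bullet> Q))"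
    unfolding d sinh_half_ln_squared[OF r] .
qed

text \<open>Through this, a comparison of \<open>Deltaprime\<close> with a distance becomes a
  comparison of a product of two hyperbolic sines with 1, which is algebraic after squaring.\<close>

lemma sinh_Deltaprime:
  assumes "dprime P Q > 0" shows "sinh (Deltaprime P Q) = 1 / sinh (dprime P Q)"
proof -
  define e where "e = exp (dprime P Q)"
  have e: "e > 1" using assms by (simp add: e_def)
  have "sinh (Deltaprime P Q) = ((e + 1) / (e - 1) - inverse ((e + 1) / (e - 1))) / 2"
    unfolding Deltaprime_def e_def[symmetric] using e by (intro sinh_ln_real) simp
  also have "\<dots> = ((e + 1)\<^sup>2 - (e - 1)\<^sup>2) / (2 * ((e + 1) * (e - 1)))"
    using e by (simp add: field_simps power2_eq_square)
  also have "\<dots> = 2 * e / (e\<^sup>2 - 1)"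
  proof -
    have "(e + 1)\<^sup>2 - (e - 1)\<^sup>2 = 2 * (2 * e)" "(e + 1) * (e - 1) = e\<^sup>2 - 1"
      by (simp_all add: power2_eq_square algebra_simps)
    then show ?thesis by (simp only: mult_divide_mult_cancel_left_if) simp
  qed
  also have "\<dots> = 1 / ((e - inverse e) / 2)" using e by (simp add: field_simps power2_eq_square)
  also have "(e - inverse e) / 2 = sinh (dprime P Q)"
    by (simp add: e_def sinh_field_def exp_minus)
  finally show ?thesis .
qed

text \<open>Below, \<open>p, q, r, m, \<alpha>, \<beta>\<close> are the entries of the Gram matrix of \<open>(1, P), (1, Q), (1, R)\<close> for the
  Minkowski form; its determinant is \<open>K\<^sup>2\<close>.\<close>
lemma Deltaprime_le_delta_iff:
  assumes P: "cmod P < 1" and Q: "cmod Q < 1" and R: "cmod R < 1"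
    and ncol: "\<not> collinear {P, Q, R}"
  shows "Deltaprime P Q \<le> delta P Q R \<longleftrightarrow>
    (1 - (cmod P)\<^sup>2) * (1 - (cmod Q)\<^sup>2) * (1 - (cmod R)\<^sup>2) \<le> (cross (Q - P) (R - P))\<^sup>2"
proof -
  define p q r where "p = 1 - P \<bullet> P" and "q = 1 - Q \<bullet> Q" and "r = 1 - R \<bullet> R"
  define m \<alpha> \<beta> where "m = 1 - P \<bullet> Q" and "\<alpha> = 1 - R \<bullet> P" and "\<beta> = 1 - R \<bullet> Q"
  define K where "K = cross (Q - P) (R - P)"
  define N where "N = m\<^sup>2 - p * q"
  define L where "L = 2 * m * \<alpha> * \<beta> - p * \<beta>\<^sup>2 - q * \<alpha>\<^sup>2"
  have ne: "P \<noteq> Q" using ncol by (auto simp: collinear_2)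
  have pos: "1 - V \<bullet> V > 0" if "cmod V < 1" for V :: complex
    using inner_self_less_1[OF that] by simp
  have pqr: "p > 0" "q > 0" "r > 0" using pos P Q R by (simp_all add: p_def q_def r_def)
  have gram: "K\<^sup>2 = L - r * N"
    unfolding K_def L_def N_def p_def q_def r_def m_def \<alpha>_def \<beta>_def cross_def inner_complex_def
    by simp algebra
  have Neq: "N = (cmod (Q - P))\<^sup>2 - (cross P Q)\<^sup>2"
    unfolding N_def p_def q_def m_def cross_def inner_complex_def cmod_power2 by simp algebra
  have d2: "(sinh (dprime P Q))\<^sup>2 = N / (p * q)" and d0: "dprime P Q \<ge> 0"
    using sinh_dprime_squared[OF P Q ne] by (simp_all add: N_def m_def p_def q_def)
  \<comment> \<open>Positivity means that the line \<open>P Q\<close> passes the origin at distance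
    less than 1.\<close>
  have N: "N > 0"
  proof -
    have "cross P Q = cross P (Q - P)" by (simp add: cross_def algebra_simps)
    also have "\<bar>\<dots>\<bar> \<le> cmod P * cmod (Q - P)"
      unfolding cross_def using abs_Im_le_cmod[of "cnj P * (Q - P)"] by (simp add: norm_mult)
    also have "\<dots> < cmod (Q - P)" using P ne by simp
    finally have "(cross P Q)\<^sup>2 < (cmod (Q - P))\<^sup>2"
      by (metis abs_ge_zero power2_abs power_strict_mono pos2)
    then show ?thesis using Neq by simp
  qed
  have d: "dprime P Q > 0"
    using d0 d2 N pqr by (cases "dprime P Q = 0") auto
  have sd: "sinh (dprime P Q) > 0" using d by simp
  have distS: "Deltaprime P Q \<le> dprime R S \<longleftrightarrow> (p * q) * (r * (1 - S \<bullet> S)) \<le> N * ((1 - R \<bullet> S)\<^sup>2 - r * (1 - S \<bullet> S))"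
    if S: "S \<in> kdisk" "on_line P Q S" for S
  proof -
    have Sd: "cmod S < 1" using S by (simp add: kdisk_def)
    have "R \<noteq> S"
    proof
      assume "R = S"
      then obtain t where "R = P + of_real t * (Q - P)" using S(2) by (auto simp: on_line_def)
      then have "\<forall>V\<in>{P, Q, R}. \<exists>c. V = P + c *\<^sub>R (Q - P)"
        by (auto simp: scaleR_conv_of_real intro: exI[of _ 0] exI[of _ 1])
      then show False using ncol unfolding collinear_alt by blast
    qed
    note dRS = sinh_dprime_squared[OF R Sd this]
    have s: "1 - S \<bullet> S > 0" by (rule pos[OF Sd])
    have "Deltaprime P Q \<le> dprime R S \<longleftrightarrow> sinh (Deltaprime P Q) \<le> sinh (dprime R S)" by simp
    also have "\<dots> \<longleftrightarrow> 1 \<le> sinh (dprime P Q) * sinh (dprime R S)"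
      unfolding sinh_Deltaprime[OF d] using sd by (simp add: field_simps)
    also have "\<dots> \<longleftrightarrow> 1 \<le> (sinh (dprime P Q) * sinh (dprime R S))\<^sup>2"
      using sd dRS(2) abs_le_square_iff[of 1 "sinh (dprime P Q) * sinh (dprime R S)"] by simp
    also have "\<dots> \<longleftrightarrow> 1 \<le> (N * ((1 - R \<bullet> S)\<^sup>2 - r * (1 - S \<bullet> S))) / ((p * q) * (r * (1 - S \<bullet> S)))"
      unfolding power_mult_distrib d2 dRS(1) r_def[symmetric] by simp
    also have "\<dots> \<longleftrightarrow> (p * q) * (r * (1 - S \<bullet> S)) \<le> N * ((1 - R \<bullet> S)\<^sup>2 - r * (1 - S \<bullet> S))"
      using pqr s by (simp add: le_divide_eq_1_pos)
    finally show ?thesis .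
  qed
  text \<open>The form \<open>N \<langle>R,S\<rangle>\<^sup>2 - L \<langle>S,S\<rangle>\<close> is a square on the plane spanned by \<open>(1, P)\<close> and \<open>(1, Q)\<close>;
    it vanishes at the foot of the perpendicular from \<open>R\<close>.\<close>
  have RS: "1 - R \<bullet> S = (1 - t) * \<alpha> + t * \<beta>"
    and SS: "1 - S \<bullet> S = (1 - t)\<^sup>2 * p + 2 * t * (1 - t) * m + t\<^sup>2 * q"
    and square: "N * (1 - R \<bullet> S)\<^sup>2 - L * (1 - S \<bullet> S)
      = ((m * \<alpha> - p * \<beta>) * (1 - t) + (q * \<alpha> - m * \<beta>) * t)\<^sup>2"
    if S: "S = P + of_real t * (Q - P)" for S t
  proof -
    show RS: "1 - R \<bullet> S = (1 - t) * \<alpha> + t * \<beta>"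
      unfolding S \<alpha>_def \<beta>_def inner_complex_def by simp algebra
    show SS: "1 - S \<bullet> S = (1 - t)\<^sup>2 * p + 2 * t * (1 - t) * m + t\<^sup>2 * q"
      unfolding S p_def q_def m_def inner_complex_def by simp algebra
    show "N * (1 - R \<bullet> S)\<^sup>2 - L * (1 - S \<bullet> S)
      = ((m * \<alpha> - p * \<beta>) * (1 - t) + (q * \<alpha> - m * \<beta>) * t)\<^sup>2"
      unfolding RS SS N_def L_def by algebra
  qed
  have L: "L > 0" using gram N pqr by (smt (verit) mult_pos_pos zero_le_power2)
  define X where "X = {dprime R S | S. S \<in> kdisk \<and> on_line P Q S}"
  have Pl: "P \<in> kdisk \<and> on_line P Q P"
    using P by (auto simp: kdisk_def on_line_def intro!: exI[of _ 0])
  have "X \<noteq> {}" using Pl by (auto simp: X_def)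
  moreover have "bdd_below X"
  proof (rule bdd_belowI[of _ 0])
    fix x assume "x \<in> X"
    then obtain S where S: "S \<in> kdisk" "x = dprime R S" by (auto simp: X_def)
    then show "0 \<le> x" using sinh_dprime_squared(2)[OF R, of S]
      by (cases "R = S") (auto simp: kdisk_def dprime_def)
  qed
  ultimately have "Deltaprime P Q \<le> delta P Q R \<longleftrightarrow> (\<forall>S. S \<in> kdisk \<and> on_line P Q S \<longrightarrow> Deltaprime P Q \<le> dprime R S)"
    unfolding delta_def X_def[symmetric] by (subst le_cInf_iff) (auto simp: X_def)
  also have "\<dots> \<longleftrightarrow> p * q * r \<le> K\<^sup>2"
  proof
    assume le: "p * q * r \<le> K\<^sup>2"
    show "\<forall>S. S \<in> kdisk \<and> on_line P Q S \<longrightarrow> Deltaprime P Q \<le> dprime R S"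
    proof (intro allI impI, elim conjE)
      fix S assume S: "S \<in> kdisk" "on_line P Q S"
      then obtain t where t: "S = P + of_real t * (Q - P)" by (auto simp: on_line_def)
      have s: "1 - S \<bullet> S > 0" using pos S(1) by (simp add: kdisk_def)
      have "(p * q) * (r * (1 - S \<bullet> S)) = (p * q * r) * (1 - S \<bullet> S)" by simp
      also have "\<dots> \<le> K\<^sup>2 * (1 - S \<bullet> S)" using le s by (intro mult_right_mono) auto
      also have "\<dots> = L * (1 - S \<bullet> S) - N * (r * (1 - S \<bullet> S))" by (simp add: gram algebra_simps)
      also have "\<dots> \<le> N * (1 - R \<bullet> S)\<^sup>2 - N * (r * (1 - S \<bullet> S))"
        using square[OF t] by (smt (verit) zero_le_power2)
      finally show "Deltaprime P Q \<le> dprime R S"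
        unfolding distS[OF S] by (simp add: right_diff_distrib)
    qed
  next
    assume all: "\<forall>S. S \<in> kdisk \<and> on_line P Q S \<longrightarrow> Deltaprime P Q \<le> dprime R S"
    \<comment> \<open>\<open>x\<close> and \<open>y\<close> are \<open>N\<close> times the
      coefficients of the Minkowski projection of \<open>(1, R)\<close> to the plane of
      \<open>(1, P)\<close> and \<open>(1, Q)\<close>, found by Cramer's rule.\<close>
    define x y where "x = m * \<beta> - q * \<alpha>" and "y = m * \<alpha> - p * \<beta>"
    have RSxy: "\<alpha> * x + \<beta> * y = L" by (simp add: x_def y_def L_def power2_eq_square algebra_simps)
    have SSxy: "p * x\<^sup>2 + 2 * m * x * y + q * y\<^sup>2 = N * L"
      unfolding x_def y_def L_def N_def by algebra
    \<comment> \<open>Otherwise the projection would be a multiple of \<open>(0, Q - P)\<close>,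
      whose Minkowski square is not positive, contrary to \<open>N * L > 0\<close>.\<close>
    have xy: "x + y \<noteq> 0"
    proof
      assume "x + y = 0"
      then have "y = - x" by simp
      then have "N * L = (p - 2 * m + q) * x\<^sup>2" using SSxy by (simp add: power2_eq_square algebra_simps)
      also have "p - 2 * m + q = - (cmod (Q - P))\<^sup>2"
        by (simp add: p_def q_def m_def power2_norm_eq_inner inner_diff inner_commute)
      also have "\<dots> * x\<^sup>2 \<le> 0" by simp
      finally show False using N L by (simp add: mult_le_0_iff)
    qed
    \<comment> \<open>Dividing by \<open>x + y\<close> normalizes the first coordinate to 1 and
      yields the foot \<open>S\<close> as a point of the plane.\<close>
    define t where "t = y / (x + y)"
    define S where "S = P + of_real t * (Q - P)"
    have t1: "1 - t = x / (x + y)" using xy by (simp add: t_def field_simps)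
    have "1 - S \<bullet> S = (p * x\<^sup>2 + 2 * m * x * y + q * y\<^sup>2) / (x + y)\<^sup>2"
      unfolding SS[OF S_def] t1 unfolding t_def
      by (simp add: power_divide add_divide_distrib power2_eq_square mult_ac)
    then have s: "1 - S \<bullet> S > 0" using SSxy N L xy by simp
    then have Sk: "S \<in> kdisk" by (simp add: kdisk_def dot_square_norm abs_square_less_1)
    have Sl: "on_line P Q S" by (auto simp: on_line_def S_def)
    have "(m * \<alpha> - p * \<beta>) * (1 - t) + (q * \<alpha> - m * \<beta>) * t = y * (1 - t) - x * t"
      by (simp add: x_def y_def algebra_simps)
    also have "\<dots> = 0" unfolding t1 by (simp add: t_def)
    finally have eq: "N * (1 - R \<bullet> S)\<^sup>2 = L * (1 - S \<bullet> S)" using square[OF S_def] by simp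
    have "(p * q) * (r * (1 - S \<bullet> S)) \<le> N * ((1 - R \<bullet> S)\<^sup>2 - r * (1 - S \<bullet> S))"
      using distS[OF Sk Sl] all Sk Sl by blast
    also have "\<dots> = K\<^sup>2 * (1 - S \<bullet> S)" using eq by (simp add: gram algebra_simps)
    finally have "(p * q * r) * (1 - S \<bullet> S) \<le> K\<^sup>2 * (1 - S \<bullet> S)" by simp
    then show "p * q * r \<le> K\<^sup>2" using s by simp
  qed
  finally show ?thesis by (simp add: p_def q_def r_def K_def dot_square_norm)
qed

section \<open>The rotation number of the triangle map\<close>

lemma chord_lift_triple_imp_area:
  assumes "cmod A < 1" "cmod B < 1" "cmod C < 1"
    and "chord_lift C (chord_lift B (chord_lift A x)) = x + 1"
  shows "(1 - (cmod A)\<^sup>2) * (1 - (cmod B)\<^sup>2) * (1 - (cmod C)\<^sup>2) \<le> (cross (B - A) (C - A))\<^sup>2"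
proof -
  have "half_turn C (half_turn B (half_turn A (circ x))) = circ (x + 1)"
    using assms by (simp flip: circ_chord_lift)
  also have "\<dots> = circ x" by (auto simp: circ_eq_iff intro: exI[of _ 1])
  finally show ?thesis
    using half_turn_triple_fixed_iff[OF assms(1-3)] norm_circ by blast
qed

text \<open>A fixed point on the circle determines the displacement of its lift only up to an
  integer, hence the alternative between the two orders.\<close>

lemma area_imp_chord_lift_triple:
  assumes "cmod A < 1" "cmod B < 1" "cmod C < 1"
    and "(1 - (cmod A)\<^sup>2) * (1 - (cmod B)\<^sup>2) * (1 - (cmod C)\<^sup>2) \<le> (cross (B - A) (C - A))\<^sup>2"
  obtains x where "chord_lift C (chord_lift B (chord_lift A x)) = x + 1
    \<or> chord_lift A (chord_lift B (chord_lift C x)) = x + 1"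
proof -
  obtain z where z: "cmod z = 1" "half_turn C (half_turn B (half_turn A z)) = z"
    using half_turn_triple_fixed_iff[OF assms(1-3)] assms(4) by blast
  obtain x where x: "z = circ x" using circ_surj[OF z(1)] .
  have "circ (chord_lift C (chord_lift B (chord_lift A x))) = circ x"
    using z(2) assms(1-3) by (simp add: x circ_chord_lift)
  then obtain k :: int where "chord_lift C (chord_lift B (chord_lift A x)) = x + of_int k"
    unfolding circ_eq_iff by blast
  from half_turn_lift_triple[OF assms(1-3)[THEN half_turn_lift_chord_lift] this] that
  show ?thesis by blast
qed

theorem theorem4p2:
  fixes P Q R :: complex
  assumes "P \<in> kdisk" and "Q \<in> kdisk" and "R \<in> kdisk"
    and "\<not> collinear {P, Q, R}"
  shows "(delta P Q R < Deltaprime P Q \<longrightarrow>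
            1/3 < rotation_number (psi_lift (triangle P Q R)) \<and>
            rotation_number (psi_lift (triangle P Q R)) < 1/2)
       \<and> (delta P Q R \<ge> Deltaprime P Q \<longrightarrow>
            rotation_number (psi_lift (triangle P Q R)) = 1/3)"
proof -
  have disk: "cmod P < 1" "cmod Q < 1" "cmod R < 1" using assms by (auto simp: kdisk_def)
  interpret three_half_turns "chord_lift P" "chord_lift Q" "chord_lift R"
    by (rule three_half_turns_chord_lift[OF disk assms(4)])
  have F: "psi_lift (triangle P Q R) = F"
    unfolding psi_lift_triangle[OF disk] by (simp add: F_def fun_eq_iff)
  note iff = Deltaprime_le_delta_iff[OF disk assms(4)]
  have gt: "rotation_number F > 1/3" if lt: "delta P Q R < Deltaprime P Q"
  proof (rule rotation_number_F_greater)
    have small: "\<not> (1 - (cmod P)\<^sup>2) * (1 - (cmod Q)\<^sup>2) * (1 - (cmod R)\<^sup>2) \<le> (cross (Q - P) (R - P))\<^sup>2"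
      using iff lt by simp
    show "chord_lift R (chord_lift Q (chord_lift P x)) \<noteq> x + 1" for x
      using chord_lift_triple_imp_area[OF disk] small by blast
    \<comment> \<open>Reversing the order only changes the sign of the determinant, so both products
      obey the same criterion.\<close>
    have "cross (Q - R) (P - R) = - cross (Q - P) (R - P)"
      by (simp add: cross_def algebra_simps)
    then show "chord_lift P (chord_lift Q (chord_lift R x)) \<noteq> x + 1" for x
      using chord_lift_triple_imp_area[OF disk(3,2,1), of x] small by (auto simp: mult_ac)
  qed
  have eq: "rotation_number F = 1/3" if ge: "delta P Q R \<ge> Deltaprime P Q"
  proof -
    obtain x where "chord_lift R (chord_lift Q (chord_lift P x)) = x + 1
        \<or> chord_lift P (chord_lift Q (chord_lift R x)) = x + 1"
      using area_imp_chord_lift_triple[OF disk iff[THEN iffD1, OF ge]] .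
    then show ?thesis using rotation_number_F_eq by blast
  qed
  show ?thesis unfolding F using gt eq rotation_number_F_less by blast
qed

end
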